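(* For a positive integer $N$, let $A_N$ be the set of $a \in \{1,\dots,N\}$ such that for every $b \in \{1,\dots,N\}$ with $a \neq b$ and $\Omega(b) \leq \Omega(a)$ we have $a+b \nmid 2ab$. Then: (1) For every positive integer $N$ and all $a,b \in A_N$ with $a \neq b$, we have $a+b \nmid 2ab$. (2) There exists a constant $c>0$ such that $|A_N| > cN$ for all sufficiently large $N$.
   Context: $\Omega(n)$ denotes the number of prime factors of the positive integer $n$ counted with multiplicity (so $\Omega(1)=0$). *)

theory Defs
  imports Complex_Main "HOL-Computational_Algebra.Primes"
begin

definition big_omega :: "nat \<Rightarrow> nat" where
  "big_omega n = size (prime_factorization n)"

definition A_set :: "nat \<Rightarrow> nat set" where
  "A_set N = {a \<in> {1..N}. \<forall>b \<in> {1..N}. a \<noteq> b \<and> big_omega b \<le> big_omega a \<longrightarrow> \<not> (a + b) dvd (2 * a * b)}"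

end

theory Submission
  imports Defs "HOL-Number_Theory.Number_Theory" "HOL-Computational_Algebra.Squarefree"
    "HOL-Analysis.Summation_Tests" "HOL-Real_Asymp.Real_Asymp"
begin

text \<open>
  Of two elements of the set, the one with at least as many prime factors excludes
  the other, so the first claim is immediate.

  For the density, write \<open>a = g x\<close> and \<open>b = g y\<close> with \<open>x\<close>, \<open>y\<close> coprime. Then \<open>a + b\<close> divides
  \<open>2 a b\<close> iff \<open>x + y\<close> divides \<open>2 g\<close>. Hence \<open>a\<close> can fail to belong to \<open>A_N\<close> only because of a pair
  \<open>(x, y)\<close> with \<open>\<Omega>(y) \<le> \<Omega>(x)\<close> such that \<open>x\<close> times \<open>x + y\<close>, up to a factor 2, divides \<open>a\<close>.
  Take \<open>a = p k\<close> with \<open>N/128 < a \<le> N\<close>, \<open>k\<close> squarefree with all prime factors between a constant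
  \<open>Z\<close> and a small power of \<open>N\<close>, and \<open>p\<close> a much larger prime. Then \<open>b \<le> N\<close> forces \<open>y < 128 x\<close>, and
  \<open>p\<close> is too large to divide \<open>x\<close> or \<open>x + y\<close>, so the obstruction sits in \<open>k\<close> and no longer depends
  on \<open>N\<close> or \<open>p\<close> (\<open>obstructed\<close>, \<open>mult_unobstructed_in_A_set\<close>). By Chebyshev's bounds every \<open>k\<close>
  leaves room for a constant times \<open>N / (k log N)\<close> primes \<open>p\<close>. It therefore suffices that
  the unobstructed \<open>k\<close> carry a positive proportion of the total weight
  \<open>\<Sum> 1/k = \<Prod> (1 + 1/p)\<close>, which is of order \<open>log N\<close> (\<open>card_A_set_lower\<close>).

  For the weights \<open>1/k\<close> the events \<open>p | k\<close> are independent. With \<open>M(K) = \<Sum> 1/p\<close> over \<open>p \<le> 2^K\<close>,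
  exponential moments show that outside a small proportion every \<open>k\<close> has at most
  \<open>21/20 M(K) + O(1)\<close> prime factors up to \<open>2^K\<close>, for all \<open>K\<close> simultaneously
  (\<open>irregular_mass\<close>). The weight of such \<open>k\<close> obstructed by a pair with \<open>x + y\<close> of size \<open>2^K\<close> is
  bounded by Rankin's trick: the bound on the number of prime factors costs a factor
  \<open>4^(21/20 M)\<close> and lets each prime factor of \<open>k\<close> be counted with weight \<open>1/4\<close>, and
  the condition \<open>\<Omega>(y) \<le> \<Omega>(x)\<close> is replaced by the factor \<open>2^(\<Omega>(x) - \<Omega>(y))\<close>. What remains is
  \<open>exp (-3/4 M)\<close> from the primes not dividing \<open>x (x + y)\<close>, times the average of
  \<open>2^(-\<omega>(x)) 2^(-\<omega>(y)) 4^(-\<omega>(x + y))\<close> over \<open>x, y < 2^K\<close>, which a sieve bounds by \<open>exp (-7/4 M)\<close> up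
  to a factor \<open>K^(1/100)\<close> (\<open>sum_factor_weight_asymptotic\<close>). Since
  \<open>21/20 log 4 - 3/4 - 7/4 < -1.03\<close> and \<open>M(K) \<ge> log K - O(1)\<close>, the contribution of scale \<open>K\<close> is
  at most a constant times \<open>K^(-1.02)\<close>. This is summable, and all prime factors of \<open>k\<close> exceed \<open>Z\<close>, so only
  \<open>K\<close> with \<open>2^K > Z\<close> matter: the total is small for \<open>Z\<close> large (\<open>obstructed_mass\<close>). The exponent
  falls below \<open>-1\<close> only thanks to the condition on \<open>\<Omega>\<close>: without it the same computation, even
  with optimal weights, gives nothing better than \<open>log 3 - 2 > -1\<close>.

  The sieve is Brun's pure sieve in two variables (\<open>pure_sieve_box\<close>): Bonferroni's inequality cuts the
  inclusion-exclusion after \<open>h\<close> primes, so that all moduli stay below the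
  side of the box, and the Chinese remainder theorem evaluates each term. It reaches the
  primes up to \<open>2^W\<close> with \<open>W\<close> of order \<open>K / log K\<close>, and \<open>M(K) - M(W)\<close> is only of order \<open>log log K\<close>.
\<close>

section \<open>Brun's pure sieve on a square box\<close>

lemma sum_Pow_prod:
  fixes f :: "'a \<Rightarrow> 'b :: comm_semiring_1"
  assumes "finite A"
  shows "(\<Sum>S\<in>Pow A. \<Prod>p\<in>S. f p) = (\<Prod>p\<in>A. 1 + f p)"
  using prod_add[OF assms, of f "\<lambda>_. 1"] by (simp add: add.commute)

definition bonferroni :: "('a \<Rightarrow> real) \<Rightarrow> 'a set \<Rightarrow> nat \<Rightarrow> real" where
  "bonferroni g A h = (\<Sum>S | S \<subseteq> A \<and> card S \<le> h. (-1) ^ card S * (\<Prod>p\<in>S. g p))"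

lemma bonferroni_0: "finite A \<Longrightarrow> bonferroni g A 0 = 1"
proof -
  assume "finite A"
  then have "{S. S \<subseteq> A \<and> card S \<le> 0} = {{}}" using finite_subset by fastforce
  then show ?thesis unfolding bonferroni_def by simp
qed

lemma bonferroni_empty: "bonferroni g {} h = 1"
proof -
  have F: "{S. S \<subseteq> {} \<and> card S \<le> h} = {{}}" by auto
  show ?thesis unfolding bonferroni_def F by simp
qed

lemma bonferroni_insert:
  assumes "finite A" "a \<notin> A"
  shows "bonferroni g (insert a A) (Suc h) = bonferroni g A (Suc h) - g a * bonferroni g A h"
proof -
  let ?f = "\<lambda>S. (-1) ^ card S * (\<Prod>p\<in>S. g p)"
  let ?F = "\<lambda>A h. {S. S \<subseteq> A \<and> card S \<le> h}"
  have fin: "finite (?F A n)" for n using assms by auto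
  have fS: "finite S" if "S \<subseteq> A" for S using that assms finite_subset by blast
  have eq: "?F (insert a A) (Suc h) = ?F A (Suc h) \<union> insert a ` ?F A h" (is "?L = ?R")
  proof
    show "?L \<subseteq> ?R"
    proof
      fix S assume S: "S \<in> ?L"
      show "S \<in> ?R"
      proof (cases "a \<in> S")
        case True
        have "finite S" using S assms finite_subset by auto
        with True S have "S - {a} \<in> ?F A h" by (auto simp: card_Diff_singleton)
        moreover have "S = insert a (S - {a})" using True by auto
        ultimately show ?thesis by blast
      qed (use S in auto)
    qed
    show "?R \<subseteq> ?L" using assms fS by (auto simp: card_insert_if)
  qed
  have inj: "inj_on (insert a) (?F A h)"
    using assms(2) by (auto simp: inj_on_def)
  have "bonferroni g (insert a A) (Suc h) = sum ?f (?F A (Suc h)) + sum ?f (insert a ` ?F A h)"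
    unfolding bonferroni_def eq using assms by (intro sum.union_disjoint) auto
  also have "sum ?f (insert a ` ?F A h) = (\<Sum>S\<in>?F A h. - g a * ?f S)"
    unfolding sum.reindex[OF inj] o_def
  proof (rule sum.cong[OF refl])
    fix S assume "S \<in> ?F A h"
    then have "finite S" "a \<notin> S" using assms fS by auto
    then show "?f (insert a S) = - g a * ?f S" by simp
  qed
  finally show ?thesis by (simp add: bonferroni_def sum_distrib_left sum_negf)
qed

text \<open>
  Both parities are proved together because adding one element to \<open>A\<close> expresses a
  truncation through those at \<open>h\<close> and \<open>h - 1\<close>, the latter with a negative coefficient.
\<close>
lemma bonferroni_inequalities:
  assumes "finite A" "\<And>p. p \<in> A \<Longrightarrow> 0 \<le> g p" "\<And>p. p \<in> A \<Longrightarrow> g p \<le> 1"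
  shows "(even h \<longrightarrow> (\<Prod>p\<in>A. 1 - g p) \<le> bonferroni g A h) \<and>
         (odd h \<longrightarrow> bonferroni g A h \<le> (\<Prod>p\<in>A. 1 - g p))"
  using assms
proof (induction A arbitrary: h rule: finite_induct)
  case empty then show ?case by (simp add: bonferroni_empty)
next
  case (insert a A)
  have pr: "(\<Prod>p\<in>insert a A. 1 - g p) = (\<Prod>p\<in>A. 1 - g p) - g a * (\<Prod>p\<in>A. 1 - g p)"
    using insert by (simp add: algebra_simps)
  show ?case
  proof (cases h)
    case 0
    have "(\<Prod>p\<in>insert a A. 1 - g p) \<le> 1"
      using insert by (intro prod_le_1) auto
    then show ?thesis using 0 insert by (simp add: bonferroni_0)
  next
    case (Suc h')
    have ga: "0 \<le> g a" using insert by simp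
    have IH: "(even k \<longrightarrow> (\<Prod>p\<in>A. 1 - g p) \<le> bonferroni g A k) \<and>
         (odd k \<longrightarrow> bonferroni g A k \<le> (\<Prod>p\<in>A. 1 - g p))" for k
      using insert by auto
    show ?thesis unfolding Suc pr bonferroni_insert[OF insert.hyps]
      using IH[of h'] IH[of "Suc h'"] ga
      by (auto intro!: diff_mono mult_left_mono)
  qed
qed

text \<open>
  The terms that a truncation drops have more than \<open>h\<close> factors. Giving every factor a
  weight 2 makes up for \<open>2 ^ h\<close>, and the weighted sum over all subsets is again a product.
\<close>
lemma bonferroni_le_prod:
  assumes A: "finite A" and g: "\<And>p. p \<in> A \<Longrightarrow> 0 \<le> g p"
  shows "bonferroni g A h \<le> (\<Prod>p\<in>A. 1 - g p) + (\<Prod>p\<in>A. 1 + 2 * g p) / 2 ^ h"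
proof -
  let ?F = "{S. S \<subseteq> A \<and> card S \<le> h}"
  let ?f = "\<lambda>S. (-1) ^ card S * (\<Prod>p\<in>S. g p)"
  have F: "?F \<subseteq> Pow A" by auto
  have "(\<Prod>p\<in>A. 1 - g p) = (\<Sum>S\<in>Pow A. \<Prod>p\<in>S. - g p)"
    using sum_Pow_prod[OF A, of "\<lambda>p. - g p"] by simp
  also have "\<dots> = (\<Sum>S\<in>Pow A. ?f S)" by (simp add: prod_uminus)
  also have "\<dots> = bonferroni g A h + (\<Sum>S\<in>Pow A - ?F. ?f S)"
    unfolding bonferroni_def using sum.subset_diff[OF F, of ?f] A by simp
  finally have eq: "bonferroni g A h - (\<Prod>p\<in>A. 1 - g p) = - (\<Sum>S\<in>Pow A - ?F. ?f S)" by simp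
  also have "\<dots> \<le> (\<Sum>S\<in>Pow A - ?F. (\<Prod>p\<in>S. 2 * g p) / 2 ^ h)"
    unfolding sum_negf[symmetric]
  proof (rule sum_mono)
    fix S assume S: "S \<in> Pow A - ?F"
    have nn: "0 \<le> (\<Prod>p\<in>S. g p)" using S g by (intro prod_nonneg) auto
    have "- ?f S \<le> (\<Prod>p\<in>S. g p)"
      using nn by (cases "even (card S)") auto
    also have "\<dots> \<le> (2 ^ card S / 2 ^ h) * (\<Prod>p\<in>S. g p)"
    proof -
      have "(1::real) \<le> 2 ^ card S / 2 ^ h" using S by (auto simp: divide_simps)
      then show ?thesis using nn mult_right_mono[of 1 "2 ^ card S / 2 ^ h" "\<Prod>p\<in>S. g p"] by simp
    qed
    also have "\<dots> = (\<Prod>p\<in>S. 2 * g p) / 2 ^ h" by (simp add: prod.distrib)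
    finally show "- ?f S \<le> (\<Prod>p\<in>S. 2 * g p) / 2 ^ h" .
  qed
  also have "\<dots> \<le> (\<Sum>S\<in>Pow A. (\<Prod>p\<in>S. 2 * g p) / 2 ^ h)"
    using A g by (intro sum_mono2 divide_nonneg_pos prod_nonneg mult_nonneg_nonneg) auto
  also have "\<dots> = (\<Prod>p\<in>A. 1 + 2 * g p) / 2 ^ h"
    unfolding sum_divide_distrib[symmetric] by (subst sum_Pow_prod[OF A]) simp
  finally show ?thesis by simp
qed

lemma bij_betw_mod_coprime:
  fixes m n :: nat
  assumes "coprime m n" "0 < m" "0 < n"
  shows "bij_betw (\<lambda>x. (x mod m, x mod n)) {..<m * n} ({..<m} \<times> {..<n})"
proof -
  have inj: "inj_on (\<lambda>x. (x mod m, x mod n)) {..<m * n}"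
  proof (rule inj_onI)
    fix x y assume xy: "x \<in> {..<m * n}" "y \<in> {..<m * n}" "(x mod m, x mod n) = (y mod m, y mod n)"
    then have "[x = y] (mod m)" "[x = y] (mod n)" by (auto simp: unique_euclidean_semiring_class.cong_def)
    then have "[x = y] (mod m * n)" using assms coprime_cong_mult_nat by blast
    then show "x = y" using xy by (auto simp: unique_euclidean_semiring_class.cong_def)
  qed
  moreover have "(\<lambda>x. (x mod m, x mod n)) ` {..<m * n} = {..<m} \<times> {..<n}"
  proof (rule card_subset_eq)
    show "card ((\<lambda>x. (x mod m, x mod n)) ` {..<m * n}) = card ({..<m} \<times> {..<n})"
      using card_image[OF inj] by simp
  qed (use assms in auto)
  ultimately show ?thesis by (auto simp: bij_betw_def)
qed

lemma sum_mod_coprime: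
  fixes m n :: nat and F :: "nat \<Rightarrow> nat \<Rightarrow> real"
  assumes "coprime m n" "0 < m" "0 < n"
  shows "(\<Sum>x<m * n. F (x mod m) (x mod n)) = (\<Sum>i<m. \<Sum>j<n. F i j)"
  using sum.reindex_bij_betw[OF bij_betw_mod_coprime[OF assms], of "\<lambda>(i, j). F i j"]
  by (simp add: sum.cartesian_product)

definition sum_box :: "nat \<Rightarrow> (nat \<Rightarrow> nat \<Rightarrow> real) \<Rightarrow> real" where
  "sum_box n F = (\<Sum>x<n. \<Sum>y<n. F x y)"

definition periodic2 :: "nat \<Rightarrow> (nat \<Rightarrow> nat \<Rightarrow> real) \<Rightarrow> bool" where
  "periodic2 n F \<longleftrightarrow> (\<forall>x y. F x y = F (x mod n) (y mod n))"

lemma periodic2D: "periodic2 n F \<Longrightarrow> F x y = F (x mod n) (y mod n)"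
  unfolding periodic2_def by blast

text \<open>
  Chinese remainder theorem in each coordinate: functions that are periodic modulo coprime
  numbers are independent over a common period.
\<close>
lemma sum_box_mult:
  assumes "coprime m n" "0 < m" "0 < n" "periodic2 m F" "periodic2 n G"
  shows "sum_box (m * n) (\<lambda>x y. F x y * G x y) = sum_box m F * sum_box n G"
proof -
  have "sum_box (m * n) (\<lambda>x y. F x y * G x y) =
        (\<Sum>x<m*n. \<Sum>y<m*n. F (x mod m) (y mod m) * G (x mod n) (y mod n))"
    unfolding sum_box_def
    by (intro sum.cong refl arg_cong2[where f="(*)"] periodic2D[OF assms(4)] periodic2D[OF assms(5)])
  also have "\<dots> = (\<Sum>x<m*n. \<Sum>i<m. \<Sum>j<n. F (x mod m) i * G (x mod n) j)"
  proof (rule sum.cong[OF refl])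
    fix x
    show "(\<Sum>y<m*n. F (x mod m) (y mod m) * G (x mod n) (y mod n)) = 
          (\<Sum>i<m. \<Sum>j<n. F (x mod m) i * G (x mod n) j)"
      by (rule sum_mod_coprime[OF assms(1-3)])
  qed
  also have "\<dots> = (\<Sum>x<m*n. (\<Sum>i<m. F (x mod m) i) * (\<Sum>j<n. G (x mod n) j))"
    by (simp add: sum_product)
  also have "\<dots> = (\<Sum>a<m. \<Sum>b<n. (\<Sum>i<m. F a i) * (\<Sum>j<n. G b j))"
    by (rule sum_mod_coprime[OF assms(1-3), of "\<lambda>a b. (\<Sum>i<m. F a i) * (\<Sum>j<n. G b j)"])
  also have "\<dots> = sum_box m F * sum_box n G"
    by (simp add: sum_box_def sum_product)
  finally show ?thesis .
qed

lemma periodic2_dvd: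
  assumes "periodic2 m F" "m dvd n" shows "periodic2 n F"
proof -
  have "F x y = F (x mod n) (y mod n)" for x y
    using periodic2D[OF assms(1), of x y] periodic2D[OF assms(1), of "x mod n" "y mod n"]
    by (simp only: mod_mod_cancel[OF assms(2)])
  then show ?thesis by (simp add: periodic2_def)
qed

lemma periodic2_prod:
  assumes "\<And>p. p \<in> S \<Longrightarrow> periodic2 p (g p)" "finite S"
  shows "periodic2 (\<Prod>S) (\<lambda>x y. \<Prod>p\<in>S. g p x y)"
proof -
  have "periodic2 (\<Prod>S) (g p)" if "p \<in> S" for p
    using periodic2_dvd[OF assms(1)[OF that]] dvd_prodI[OF assms(2) that, of id] by simp
  then show ?thesis unfolding periodic2_def[of "\<Prod>S" "\<lambda>x y. \<Prod>p\<in>S. g p x y"]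
    by (intro allI prod.cong refl periodic2D)
qed

lemma sum_box_prod_primes:
  fixes S :: "nat set"
  assumes "finite S" "\<And>p. p \<in> S \<Longrightarrow> prime p" "\<And>p. p \<in> S \<Longrightarrow> periodic2 p (g p)"
  shows "sum_box (\<Prod>S) (\<lambda>x y. \<Prod>p\<in>S. g p x y) = (\<Prod>p\<in>S. sum_box p (g p))"
  using assms
proof (induction S rule: finite_induct)
  case empty then show ?case by (simp add: sum_box_def)
next
  case (insert a S)
  have "coprime a (\<Prod>S)"
    using insert by (intro prod_coprime_right) (auto intro!: primes_coprime)
  moreover have "0 < \<Prod>S" using insert by (intro prod_pos) (auto intro: prime_gt_0_nat)
  ultimately show ?case
    using insert sum_box_mult[of a "\<Prod>S" "g a" "\<lambda>x y. \<Prod>p\<in>S. g p x y"]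
      periodic2_prod[of S g] by (auto simp: prime_gt_0_nat)
qed

lemma sum_box_periodic_multiple:
  assumes "periodic2 d F" 
  shows "sum_box (q * d) F = real q ^ 2 * sum_box d F"
proof -
  have one: "(\<Sum>x<q * d. f (x mod d)) = real q * (\<Sum>x<d. f x)" for f :: "nat \<Rightarrow> real"
  proof (cases "d = 0")
    case False
    have "(\<Sum>x<q * d. f (x mod d)) = (\<Sum>m<q. \<Sum>x=m*d..<m*d+d. f (x mod d))"
      by (rule sum.nat_group[symmetric])
    also have "\<dots> = (\<Sum>m<q. \<Sum>x<d. f x)"
    proof (rule sum.cong[OF refl])
      fix m assume "m \<in> {..<q}"
      have "(\<Sum>x=m*d..<m*d+d. f (x mod d)) = (\<Sum>x=0..<d. f ((x + m * d) mod d))"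
        using sum.shift_bounds_nat_ivl[of "\<lambda>x. f (x mod d)" 0 "m*d" d] by (simp add: add.commute)
      also have "\<dots> = (\<Sum>x<d. f x)" by (intro sum.cong) (auto simp: atLeast0LessThan)
      finally show "(\<Sum>x=m*d..<m*d+d. f (x mod d)) = (\<Sum>x<d. f x)" .
    qed
    finally show ?thesis by simp
  qed simp
  have "sum_box (q * d) F = (\<Sum>x<q*d. \<Sum>y<q*d. F (x mod d) (y mod d))"
    unfolding sum_box_def by (intro sum.cong refl periodic2D[OF assms])
  also have "\<dots> = (\<Sum>x<q*d. real q * (\<Sum>y<d. F (x mod d) y))"
    by (intro sum.cong refl) (rule one)
  also have "\<dots> = real q * (\<Sum>x<d. real q * (\<Sum>y<d. F x y))"
    by (rule one)
  finally show ?thesis by (simp add: sum_box_def sum_distrib_left power2_eq_square mult.assoc)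
qed

lemma sum_box_mono:
  assumes "m \<le> n" "\<And>x y. 0 \<le> F x y"
  shows "sum_box m F \<le> sum_box n F"
  unfolding sum_box_def
proof -
  have "(\<Sum>x<m. \<Sum>y<m. F x y) \<le> (\<Sum>x<m. \<Sum>y<n. F x y)"
    using assms by (intro sum_mono sum_mono2) auto
  also have "\<dots> \<le> (\<Sum>x<n. \<Sum>y<n. F x y)"
    using assms by (intro sum_mono2 sum_nonneg) auto
  finally show "(\<Sum>x<m. \<Sum>y<m. F x y) \<le> (\<Sum>x<n. \<Sum>y<n. F x y)" .
qed

text \<open>
  The box lies between two boxes whose sides are consecutive multiples of \<open>d\<close>, on which the sum is exact.
\<close>
lemma sum_box_periodic_approx:
  assumes per: "periodic2 d F" and nn: "\<And>x y. 0 \<le> F x y" and le1: "\<And>x y. F x y \<le> 1"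
    and d: "0 < d" "d \<le> T"
  shows "\<bar>sum_box T F - real T ^ 2 * (sum_box d F / real d ^ 2)\<bar> \<le> 3 * real T * real d"
proof -
  define q where "q = T div d"
  define \<mu> where "\<mu> = sum_box d F / real d ^ 2"
  have "sum_box d F \<le> (\<Sum>x<d. \<Sum>y<d. 1)"
    unfolding sum_box_def using le1 by (intro sum_mono)
  then have m1: "\<mu> \<le> 1" using d by (simp add: \<mu>_def power2_eq_square divide_simps)
  have m0: "0 \<le> \<mu>" unfolding \<mu>_def sum_box_def using nn by (intro divide_nonneg_nonneg sum_nonneg) auto
  have M: "sum_box d F = \<mu> * real d ^ 2" using d by (simp add: \<mu>_def)
  have q1: "q * d \<le> T" by (simp add: q_def)
  have q2: "T \<le> (q + 1) * d" unfolding q_def using dividend_less_div_times[OF d(1), of T] by simp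
  have lo: "(real q * real d)\<^sup>2 * \<mu> \<le> sum_box T F"
    using sum_box_mono[OF q1, of F] nn sum_box_periodic_multiple[OF per, of q] M
    by (simp add: power_mult_distrib mult_ac)
  have hi: "sum_box T F \<le> (real (q + 1) * real d)\<^sup>2 * \<mu>"
    using sum_box_mono[OF q2, of F] nn sum_box_periodic_multiple[OF per, of "q+1"] M
    by (simp add: power_mult_distrib mult_ac)
  have r1: "real q * real d \<le> real T" using q1 by (metis of_nat_le_iff of_nat_mult)
  have r2: "real T \<le> real (q+1) * real d" using q2 by (metis of_nat_le_iff of_nat_mult)
  have t1: "(real q * real d)\<^sup>2 * \<mu> \<le> real T ^ 2 * \<mu>"
    using r1 m0 by (intro mult_right_mono power_mono) auto
  have t2: "real T ^ 2 * \<mu> \<le> (real (q + 1) * real d)\<^sup>2 * \<mu>"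
    using r2 m0 by (intro mult_right_mono power_mono) auto
  have "(real (q + 1) * real d)\<^sup>2 * \<mu> - (real q * real d)\<^sup>2 * \<mu> = (2 * (real q * real d) * real d + real d * real d) * \<mu>"
    by (simp add: algebra_simps power2_eq_square)
  also have "\<dots> \<le> (2 * (real q * real d) * real d + real d * real d) * 1"
    using m1 by (intro mult_left_mono) auto
  also have "\<dots> \<le> 2 * real T * real d + real T * real d"
  proof -
    have "(real q * real d) * real d \<le> real T * real d" using r1 by (rule mult_right_mono) simp
    moreover have "real d * real d \<le> real T * real d" using d by (intro mult_right_mono) auto
    moreover have "(2 * (real q * real d) * real d + real d * real d) * 1 =
        2 * (real q * real d * real d) + real d * real d" by simp
    moreover have "2 * real T * real d + real T * real d = 3 * (real T * real d)" by simp
    ultimately show ?thesis by linarith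
  qed
  finally have "(real (q + 1) * real d)\<^sup>2 * \<mu> - (real q * real d)\<^sup>2 * \<mu> \<le> 3 * real T * real d" by simp
  with lo hi t1 t2 show ?thesis unfolding \<mu>_def[symmetric] by linarith
qed

text \<open>
  Brun's pure sieve. The quantity \<open>\<gamma> p\<close> is the density removed by the prime \<open>p\<close>. Replacing the
  terms of the truncated expansion by their densities costs at most \<open>3 T D\<close> for each set
  \<open>S\<close> of at most \<open>h\<close> primes, and there are at most \<open>D\<close> such sets since \<open>S\<close> is determined by
  its product.
\<close>
proposition pure_sieve_box:
  fixes A :: "nat set" and g :: "nat \<Rightarrow> nat \<Rightarrow> nat \<Rightarrow> real"
  assumes A: "finite A" "\<And>p. p \<in> A \<Longrightarrow> prime p"
    and per: "\<And>p. p \<in> A \<Longrightarrow> periodic2 p (g p)"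
    and g0: "\<And>p x y. p \<in> A \<Longrightarrow> 0 \<le> g p x y" and g1: "\<And>p x y. p \<in> A \<Longrightarrow> g p x y \<le> 1"
    and D: "\<And>S. S \<subseteq> A \<Longrightarrow> card S \<le> h \<Longrightarrow> \<Prod>S \<le> D" "D \<le> T"
    and h: "even h"
  defines "\<gamma> \<equiv> \<lambda>p. sum_box p (g p) / real p ^ 2"
  shows "sum_box T (\<lambda>x y. \<Prod>p\<in>A. 1 - g p x y) \<le>
      real T ^ 2 * ((\<Prod>p\<in>A. 1 - \<gamma> p) + (\<Prod>p\<in>A. 1 + 2 * \<gamma> p) / 2 ^ h) + 3 * real T * real D ^ 2"
proof -
  let ?F = "{S. S \<subseteq> A \<and> card S \<le> h}"
  have finF: "finite ?F" using A by auto
  have fS: "finite S" if "S \<in> ?F" for S using that A finite_subset by blast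
  have cardF: "card ?F \<le> D"
  proof -
    have inj: "inj_on (\<lambda>S. \<Prod>S) ?F"
    proof (rule inj_onI)
      fix S S' assume *: "S \<in> ?F" "S' \<in> ?F" "\<Prod>S = \<Prod>S'"
      have "prime_factors (\<Prod>R) = R" if "R \<in> ?F" for R
      proof -
        have "0 \<notin> R" using that A(2)[of 0] by auto
        then have "prime_factors (\<Prod>R) = (\<Union>p\<in>R. prime_factors p)"
          using fS[OF that] prime_factors_prod[of R "\<lambda>x. x"] by simp
        also have "\<dots> = (\<Union>p\<in>R. {p})"
          using that A by (intro SUP_cong refl) (auto simp: prime_factorization_prime)
        finally show ?thesis by simp
      qed
      then show "S = S'" using * by metis
    qed
    have "(\<lambda>S. \<Prod>S) ` ?F \<subseteq> {1..D}"
    proof clarsimp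
      fix S assume S: "S \<subseteq> A" "card S \<le> h"
      have "0 < \<Prod>S" using S A by (intro prod_pos) (auto intro!: prime_gt_0_nat)
      then show "Suc 0 \<le> \<Prod>S \<and> \<Prod>S \<le> D" using D(1)[OF S] by simp
    qed
    then show ?thesis using card_inj_on_le[OF inj, of "{1..D}"] by simp
  qed
  have "sum_box T (\<lambda>x y. \<Prod>p\<in>A. 1 - g p x y) \<le> sum_box T (\<lambda>x y. bonferroni (\<lambda>p. g p x y) A h)"
    unfolding sum_box_def using bonferroni_inequalities[OF A(1)] g0 g1 h
    by (intro sum_mono) auto
  also have "\<dots> = (\<Sum>S\<in>?F. (-1) ^ card S * sum_box T (\<lambda>x y. \<Prod>p\<in>S. g p x y))"
  proof -
    have "sum_box T (\<lambda>x y. bonferroni (\<lambda>p. g p x y) A h) = 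
      (\<Sum>x<T. \<Sum>S\<in>?F. \<Sum>y<T. (-1) ^ card S * (\<Prod>p\<in>S. g p x y))"
      unfolding sum_box_def bonferroni_def by (intro sum.cong refl sum.swap)
    also have "\<dots> = (\<Sum>S\<in>?F. \<Sum>x<T. \<Sum>y<T. (-1) ^ card S * (\<Prod>p\<in>S. g p x y))"
      by (rule sum.swap)
    finally show ?thesis by (simp add: sum_box_def sum_distrib_left)
  qed
  also have "\<dots> \<le> (\<Sum>S\<in>?F. real T ^ 2 * ((-1) ^ card S * (\<Prod>p\<in>S. \<gamma> p)) + 3 * real T * real D)"
  proof (rule sum_mono)
    fix S assume S: "S \<in> ?F"
    have pos: "0 < \<Prod>S" using S A by (intro prod_pos) (auto intro!: prime_gt_0_nat)
    have "\<Prod>S \<le> D" using D(1) S by auto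
    have per': "periodic2 (\<Prod>S) (\<lambda>x y. \<Prod>p\<in>S. g p x y)"
      using S per fS[OF S] by (intro periodic2_prod) auto
    have eqb: "sum_box (\<Prod>S) (\<lambda>x y. \<Prod>p\<in>S. g p x y) / real (\<Prod>S) ^ 2 = (\<Prod>p\<in>S. \<gamma> p)"
      using S A per fS[OF S] 
      by (subst sum_box_prod_primes) (auto simp: \<gamma>_def prod_dividef prod_power_distrib)
    have "\<bar>sum_box T (\<lambda>x y. \<Prod>p\<in>S. g p x y) - real T ^ 2 * (\<Prod>p\<in>S. \<gamma> p)\<bar> \<le> 3 * real T * real (\<Prod>S)"
      unfolding eqb[symmetric] using S g0 g1 pos order_trans[OF \<open>\<Prod>S \<le> D\<close> D(2)]
      by (intro sum_box_periodic_approx[OF per']) (auto intro!: prod_nonneg prod_le_1)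
    also have "\<dots> \<le> 3 * real T * real D" using \<open>\<Prod>S \<le> D\<close> by (intro mult_left_mono of_nat_mono) auto
    finally show "(-1) ^ card S * sum_box T (\<lambda>x y. \<Prod>p\<in>S. g p x y) \<le>
       real T ^ 2 * ((-1) ^ card S * (\<Prod>p\<in>S. \<gamma> p)) + 3 * real T * real D"
      by (cases "even (card S)") (auto simp: abs_le_iff)
  qed
  also have "\<dots> = real T ^ 2 * bonferroni \<gamma> A h + real (card ?F) * (3 * real T * real D)"
    by (simp add: sum.distrib sum_distrib_left bonferroni_def)
  also have "\<dots> \<le> real T ^ 2 * ((\<Prod>p\<in>A. 1 - \<gamma> p) + (\<Prod>p\<in>A. 1 + 2 * \<gamma> p) / 2 ^ h) + real D * (3 * real T * real D)"
  proof (intro add_mono mult_left_mono mult_right_mono)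
    show "bonferroni \<gamma> A h \<le> (\<Prod>p\<in>A. 1 - \<gamma> p) + (\<Prod>p\<in>A. 1 + 2 * \<gamma> p) / 2 ^ h"
      using g0 by (intro bonferroni_le_prod A) (auto simp: \<gamma>_def sum_box_def intro!: sum_nonneg divide_nonneg_nonneg)
  qed (use cardF in auto)
  finally show ?thesis by (simp add: power2_eq_square mult_ac)
qed

section \<open>Elementary estimates for primes\<close>

definition primes_upto :: "nat \<Rightarrow> nat set" where
  "primes_upto n = {p. prime p \<and> p \<le> n}"

lemma finite_primes_upto [simp]: "finite (primes_upto n)"
  by (rule finite_subset[of _ "{..n}"]) (auto simp: primes_upto_def)

lemma primes_upto_mono: "m \<le> n \<Longrightarrow> primes_upto m \<subseteq> primes_upto n"
  by (auto simp: primes_upto_def)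

lemma in_primes_upto [simp]: "p \<in> primes_upto n \<longleftrightarrow> prime p \<and> p \<le> n"
  by (simp add: primes_upto_def)

lemma central_binomial_fact: "fact (2 * n) = fact n * fact n * ((2 * n) choose n :: nat)"
  using binomial_fact_lemma[of n "2 * n"] by simp

lemma prod_dvd_of_coprime:
  fixes A :: "nat set"
  assumes "\<And>p. p \<in> A \<Longrightarrow> p dvd n" "\<And>p q. p \<in> A \<Longrightarrow> q \<in> A \<Longrightarrow> p \<noteq> q \<Longrightarrow> coprime p q"
  shows "\<Prod>A dvd n"
  using assms
proof (induction A rule: infinite_finite_induct)
  case (insert a A)
  have "coprime a (\<Prod>A)" using insert by (intro prod_coprime_right) auto
  then show ?case using insert by (auto intro: divides_mult)
qed auto

lemma prod_primes_dvd_central_binomial: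
  "\<Prod>(primes_upto (2 * n) - primes_upto n) dvd ((2 * n) choose n)"
proof (rule prod_dvd_of_coprime)
  fix p assume "p \<in> primes_upto (2 * n) - primes_upto n"
  then have p: "prime p" "p \<le> 2 * n" "n < p" by auto
  have "p dvd fact (2 * n)" using p prime_dvd_fact_iff by blast
  moreover have "\<not> p dvd fact n" using p prime_dvd_fact_iff[of p n] by auto
  ultimately show "p dvd ((2 * n) choose n)"
    using p by (auto simp: central_binomial_fact prime_dvd_mult_iff)
next
  fix p q assume "p \<in> primes_upto (2 * n) - primes_upto n" "q \<in> primes_upto (2 * n) - primes_upto n" "p \<noteq> q"
  then show "coprime p q" by (auto intro: primes_coprime)
qed

text \<open>
  All primes in \<open>(n, 2 n]\<close> divide the central binomial coefficient, which is at most \<open>4 ^ n\<close>.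
\<close>
lemma card_primes_dyadic:
  "l * card (primes_upto (2 ^ Suc l) - primes_upto (2 ^ l)) \<le> 2 ^ Suc l"
proof -
  define n :: nat where "n = 2 ^ l"
  let ?P = "primes_upto (2 * n) - primes_upto n"
  have "n ^ card ?P \<le> \<Prod>?P"
    using prod_mono[of ?P "\<lambda>_. n" "\<lambda>p. p"] by (simp add: not_le less_imp_le)
  also have "\<dots> \<le> (2 * n) choose n"
    by (intro dvd_imp_le prod_primes_dvd_central_binomial) auto
  also have "\<dots> \<le> 2 ^ (2 * n)" by (rule binomial_le_pow2)
  finally have "(2::nat) ^ (l * card ?P) \<le> 2 ^ (2 * n)" by (simp add: n_def power_mult)
  then show ?thesis unfolding n_def by simp
qed

definition recip_primes :: "nat \<Rightarrow> real" where
  "recip_primes K = (\<Sum>p\<in>primes_upto (2 ^ K). 1 / real p)"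

lemma sum_primes_dyadic_step:
  "(\<Sum>p\<in>primes_upto (2 ^ Suc l). f p) = 
   (\<Sum>p\<in>primes_upto (2 ^ l). f p) + (\<Sum>p\<in>primes_upto (2 ^ Suc l) - primes_upto (2 ^ l). f p :: real)"
  by (subst sum.subset_diff[OF primes_upto_mono[of "2^l" "2 ^ Suc l"]]) auto

lemma sum_primes_dyadic_block:
  assumes "0 < l" "0 \<le> c" "\<And>p. prime p \<Longrightarrow> p \<le> 2 ^ Suc l \<Longrightarrow> f p \<le> c"
  shows "(\<Sum>p\<in>primes_upto (2 ^ Suc l) - primes_upto (2 ^ l). f p / real p) \<le> 2 * c / real l"
proof -
  let ?P = "primes_upto (2 ^ Suc l) - primes_upto (2 ^ l)"
  have "(\<Sum>p\<in>?P. f p / real p) \<le> (\<Sum>p\<in>?P. c / 2 ^ l)"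
  proof (rule sum_mono)
    fix p assume p: "p \<in> ?P"
    then have "f p \<le> c" using assms by auto
    have "(2::real) ^ l \<le> real p" using p
      by (metis DiffE in_primes_upto linorder_le_cases of_nat_mono of_nat_numeral of_nat_power)
    have "f p / real p \<le> c / real p" using \<open>f p \<le> c\<close> by (intro divide_right_mono) auto
    also have "\<dots> \<le> c / 2 ^ l" using \<open>2 ^ l \<le> real p\<close> assms p
      by (intro divide_left_mono mult_pos_pos) (auto simp: prime_gt_0_nat)
    finally show "f p / real p \<le> c / 2 ^ l" .
  qed
  also have "\<dots> = c / 2 ^ l * real (card ?P)" by simp
  also have "\<dots> \<le> c / 2 ^ l * (2 ^ Suc l / real l)"
  proof (intro mult_left_mono)
    have "real l * real (card ?P) \<le> 2 ^ Suc l"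
      using card_primes_dyadic[of l] by (metis of_nat_le_iff of_nat_mult of_nat_numeral of_nat_power)
    then show "real (card ?P) \<le> 2 ^ Suc l / real l" using assms by (simp add: field_simps)
  qed (use assms in auto)
  finally show ?thesis by (simp add: mult.commute)
qed

lemma recip_primes_Suc: "0 < l \<Longrightarrow> recip_primes (Suc l) \<le> recip_primes l + 2 / real l"
  using sum_primes_dyadic_step[of "\<lambda>p. 1 / real p" l] sum_primes_dyadic_block[of l 1 "\<lambda>_. 1"]
  by (simp add: recip_primes_def)

lemma recip_primes_mono: "a \<le> b \<Longrightarrow> recip_primes a \<le> recip_primes b"
  unfolding recip_primes_def by (intro sum_mono2 primes_upto_mono) auto

text \<open>
  Dyadic blocks contribute at most \<open>2 / j\<close>, whence the logarithm of the quotient of the exponents.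
\<close>
lemma recip_primes_increment:
  assumes "0 < W" "W \<le> K"
  shows "recip_primes K \<le> recip_primes W + 2 + 2 * ln (real K / real W)"
proof -
  have "recip_primes (Suc K) \<le> recip_primes W + 2 / real W + 2 * ln (real K / real W)" if "W \<le> K" for K
    using that
  proof (induction K rule: dec_induct)
    case base
    then show ?case using recip_primes_Suc[OF assms(1)] assms by simp
  next
    case (step n)
    have n: "0 < n" using step assms by simp
    have "1 / real (Suc n) \<le> ln (real (Suc n) / real n)"
    proof -
      have "ln (real n / real (Suc n)) \<le> real n / real (Suc n) - 1"
        using n by (intro ln_le_minus_one) auto
      also have "\<dots> = - (1 / real (Suc n))" by (simp add: field_simps)
      finally show ?thesis using n by (simp add: ln_div)
    qed
    moreover have "ln (real (Suc n) / real W) = ln (real (Suc n) / real n) + ln (real n / real W)"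
      using n assms by (simp add: ln_div)
    moreover have "recip_primes (Suc (Suc n)) \<le> recip_primes (Suc n) + 2 / real (Suc n)"
      by (rule recip_primes_Suc) simp
    ultimately show ?case using step.IH by (simp add: algebra_simps)
  qed
  from this[OF assms(2)] have "recip_primes (Suc K) \<le> recip_primes W + 2 / real W + 2 * ln (real K / real W)" .
  moreover have "2 / real W \<le> 2" using assms by (simp add: divide_simps)
  ultimately show ?thesis using recip_primes_mono[of K "Suc K"] by linarith
qed

lemma primes_upto_2: "primes_upto 2 = {2}"
  by (auto simp: primes_upto_def dest: prime_ge_2_nat) 

lemma recip_primes_1: "recip_primes 1 = 1 / 2"
  by (simp add: recip_primes_def primes_upto_2)

lemma recip_primes_upper: "0 < K \<Longrightarrow> recip_primes K \<le> 3 + 2 * ln (real K)"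
  using recip_primes_increment[of 1 K] recip_primes_1 by simp

lemma sum_ln_primes_upper: "(\<Sum>p\<in>primes_upto (2 ^ J). ln (real p) / real p) \<le> (4 * real J) * ln 2"
proof (induction J)
  case 0
  have "primes_upto (Suc 0) = {}" by (auto simp: primes_upto_def dest: prime_ge_2_nat)
  then show ?case by simp
next
  case (Suc J)
  show ?case
  proof (cases "J = 0")
    case True then show ?thesis by (simp add: primes_upto_2)
  next
    case False
    have "(\<Sum>p\<in>primes_upto (2 ^ Suc J) - primes_upto (2 ^ J). ln (real p) / real p) \<le> 
        2 * (real (Suc J) * ln 2) / real J"
    proof (rule sum_primes_dyadic_block)
      fix p :: nat assume "prime p" "p \<le> 2 ^ Suc J"
      then have "real p \<le> 2 ^ Suc J" by (metis of_nat_le_iff of_nat_numeral of_nat_power)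
      then have "ln (real p) \<le> ln (2 ^ Suc J)" using \<open>prime p\<close> by (subst ln_le_cancel_iff) (auto simp: prime_gt_0_nat)
      then show "ln (real p) \<le> real (Suc J) * ln 2" using ln_realpow[of 2 "Suc J"] by simp
    qed (use False in auto)
    also have "\<dots> = 2 * ln 2 * (real (Suc J) / real J)" by simp
    also have "\<dots> \<le> 2 * ln 2 * 2" using False by (intro mult_left_mono) (auto simp: field_simps)
    finally show ?thesis using Suc sum_primes_dyadic_step[of "\<lambda>p. ln (real p) / real p" J] by (simp add: algebra_simps)
  qed
qed

text \<open>
  Legendre's formula. All terms with \<open>i > n\<close> vanish, so any cut-off \<open>L \<ge> n\<close> gives the same sum.
\<close>
lemma multiplicity_fact_Legendre:
  fixes p :: nat
  assumes "prime p" "n \<le> L"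
  shows "multiplicity p (fact n :: nat) = (\<Sum>i=1..L. n div p ^ i)"
  using assms(2)
proof (induction n)
  case 0 then show ?case by simp
next
  case (Suc n)
  have "multiplicity p (fact (Suc n) :: nat) = multiplicity p (Suc n) + multiplicity p (fact n :: nat)"
    using assms by (simp only: fact_Suc of_nat_id) (subst prime_elem_multiplicity_mult_distrib, auto)
  also have "multiplicity p (Suc n) = (\<Sum>i=1..L. if p ^ i dvd Suc n then 1 else 0)"
  proof -
    have "multiplicity p (Suc n) \<le> Suc n"
    proof -
      have "multiplicity p (Suc n) < 2 ^ multiplicity p (Suc n)" by simp
      also have "\<dots> \<le> p ^ multiplicity p (Suc n)" using prime_ge_2_nat[OF assms(1)] by (intro power_mono) auto
      also have "\<dots> \<le> Suc n" by (intro dvd_imp_le multiplicity_dvd) auto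
      finally show ?thesis by simp
    qed
    then have "i \<in> {i\<in>{1..L}. p ^ i dvd Suc n} \<longleftrightarrow> i \<in> {1..multiplicity p (Suc n)}" for i
    proof -
      have "p ^ i dvd Suc n \<longleftrightarrow> i \<le> multiplicity p (Suc n)"
        using prime_gt_1_nat[OF assms(1)] by (intro power_dvd_iff_le_multiplicity) auto
      then show ?thesis using Suc.prems \<open>multiplicity p (Suc n) \<le> Suc n\<close> by (simp only: mem_Collect_eq atLeastAtMost_iff) linarith
    qed
    then have "{i\<in>{1..L}. p ^ i dvd Suc n} = {1..multiplicity p (Suc n)}" by blast
    then show ?thesis by (simp add: sum.If_cases Int_def)
  qed
  also have "multiplicity p (fact n :: nat) = (\<Sum>i=1..L. n div p ^ i)" using Suc by simp
  also have "(\<Sum>i=1..L. if p ^ i dvd Suc n then 1 else 0) + (\<Sum>i=1..L. n div p ^ i) = (\<Sum>i=1..L. Suc n div p ^ i)"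
    unfolding sum.distrib[symmetric]
    by (intro sum.cong refl) (auto simp: div_Suc dvd_eq_mod_eq_0)
  finally show ?case .
qed

text \<open>
  By Legendre's formula the multiplicity is a sum of terms 0 or 1, one for
  each power of \<open>p\<close> up to \<open>2 n\<close>.
\<close>
lemma prime_power_multiplicity_central_binomial:
  assumes "prime p" "0 < n"
  shows "p ^ multiplicity p ((2 * n) choose n) \<le> 2 * n"
proof -
  let ?C = "(2 * n) choose n"
  let ?v = "multiplicity p ?C"
  define E where "E = {i \<in> {1..2 * n}. p ^ i \<le> 2 * n}"
  have "multiplicity p (fact (2 * n) :: nat) = 2 * multiplicity p (fact n :: nat) + ?v"
    unfolding central_binomial_fact using assms
    by (simp add: prime_elem_multiplicity_mult_distrib)
  then have "(\<Sum>i=1..2 * n. (2 * n) div p ^ i) = (\<Sum>i=1..2 * n. 2 * (n div p ^ i)) + ?v"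
    using multiplicity_fact_Legendre[OF assms(1), of "2*n" "2*n"] multiplicity_fact_Legendre[OF assms(1), of "n" "2*n"]
    by (simp add: sum_distrib_left)
  moreover have "(\<Sum>i=1..2 * n. (2 * n) div p ^ i) \<le> (\<Sum>i=1..2 * n. 2 * (n div p ^ i) + (if p ^ i \<le> 2 * n then 1 else 0))"
  proof (rule sum_mono)
    fix i
    have pos: "0 < p ^ i" using assms prime_gt_0_nat by simp
    have "2 * n div p ^ i < 2 * (n div p ^ i) + 2"
    proof -
      have "n < (n div p ^ i + 1) * p ^ i" using dividend_less_div_times[OF pos, of n] by simp
      then have "2 * n < (2 * (n div p ^ i) + 2) * p ^ i" by (simp add: algebra_simps)
      then show ?thesis using pos by (simp add: less_mult_imp_div_less)
    qed
    then show "2 * n div p ^ i \<le> 2 * (n div p ^ i) + (if p ^ i \<le> 2 * n then 1 else 0)"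
      by auto
  qed
  moreover have "(\<Sum>i=1..2 * n. (if p ^ i \<le> 2 * n then 1 else 0)) = card E"
    by (simp add: sum.If_cases Int_def E_def)
  ultimately have v: "?v \<le> card E" by (simp add: sum.distrib)
  show ?thesis
  proof (cases "E = {}")
    case True then show ?thesis using v assms by simp
  next
    case False
    have fin: "finite E" by (simp add: E_def)
    have "E \<subseteq> {1..Max E}" using fin by (auto simp: E_def)
    then have "card E \<le> Max E" using card_mono[of "{1..Max E}" E] by simp
    then have "p ^ ?v \<le> p ^ Max E" using v assms prime_gt_0_nat by (intro power_increasing) (auto simp: Suc_le_eq)
    also have "\<dots> \<le> 2 * n" using Max_in[OF fin False] by (simp add: E_def)
    finally show ?thesis .
  qed
qed

text \<open>
  By the previous bound on prime powers the central binomial coefficient, of size about \<open>4 ^ n\<close>, is at most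
  \<open>2 n\<close> to the number of primes up to \<open>2 n\<close>.
\<close>
lemma card_primes_lower:
  assumes "0 < j"
  shows "2 ^ j \<le> 2 * j * card (primes_upto (2 ^ j))"
proof -
  obtain j' where j: "j = Suc j'" using assms by (cases j) auto
  define n :: nat where "n = 2 ^ j'"
  let ?C = "(2 * n) choose n"
  have n: "0 < n" "2 * n = 2 ^ j" by (auto simp: n_def j)
  have sub: "prime_factors ?C \<subseteq> primes_upto (2 * n)"
  proof
    fix p assume p: "p \<in> prime_factors ?C"
    then have "prime p" "p dvd ?C" by auto
    have "p dvd fact (2 * n)"
      unfolding central_binomial_fact using \<open>p dvd ?C\<close> by (rule dvd_mult)
    then show "p \<in> primes_upto (2 * n)" using \<open>prime p\<close> prime_dvd_fact_iff by auto
  qed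
  have "?C = (\<Prod>p\<in>prime_factors ?C. p ^ multiplicity p ?C)"
    using prod_prime_factors[of ?C] by simp
  also have "\<dots> \<le> (\<Prod>p\<in>prime_factors ?C. 2 * n)"
    using n(1) by (intro prod_mono conjI prime_power_multiplicity_central_binomial) auto
  also have "\<dots> = (2 * n) ^ card (prime_factors ?C)" by simp
  also have "\<dots> \<le> (2 * n) ^ card (primes_upto (2 * n))"
    using n by (intro power_increasing card_mono sub) auto
  finally have "real ?C \<le> (2 * real n) ^ card (primes_upto (2 * n))"
    by (metis of_nat_le_iff of_nat_mult of_nat_numeral of_nat_power)
  moreover have "4 ^ n / (2 * real n) \<le> real ?C" using n by (intro central_binomial_lower_bound)
  ultimately have "4 ^ n / (2 * real n) \<le> (2 * real n) ^ card (primes_upto (2 * n))" by linarith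
  then have "4 ^ n \<le> (2 * real n) ^ card (primes_upto (2 * n)) * (2 * real n)"
    using n(1) by (subst (asm) pos_divide_le_eq) auto
  then have "4 ^ n \<le> (2 * real n) ^ Suc (card (primes_upto (2 * n)))"
    by (simp add: mult.commute)
  then have "(2::real) ^ (2 * n) \<le> 2 ^ (j * Suc (card (primes_upto (2 ^ j))))"
  proof -
    have e: "2 * real n = 2 ^ j" by (simp add: n_def j)
    have four: "(2::real) ^ (2 * n) = 4 ^ n" by (simp only: power_mult) simp
    show ?thesis using \<open>4 ^ n \<le> (2 * real n) ^ Suc _\<close>[unfolded e n(2)]
      by (subst four) (simp add: power_add power_mult)
  qed
  then have "2 ^ j \<le> j * Suc (card (primes_upto (2 ^ j)))" using n by simp
  also have "\<dots> \<le> j * (2 * card (primes_upto (2 ^ j)))"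
  proof (rule mult_left_mono)
    have "2 \<in> primes_upto (2 ^ j)" using n(2) n(1) by (auto simp: Suc_le_eq)
    then have "0 < card (primes_upto (2 ^ j))" unfolding card_gt_0_iff by (auto simp del: in_primes_upto)
    then show "Suc (card (primes_upto (2 ^ j))) \<le> 2 * card (primes_upto (2 ^ j))" by simp
  qed auto
  finally show ?thesis by (simp add: mult_ac)
qed

lemma card_primes_upper:
  assumes "0 < i"
  shows "i * card (primes_upto (2 ^ i)) \<le> 6 * 2 ^ i"
  using assms
proof (induction i rule: nat_induct_non_zero)
  case 1 then show ?case by (simp add: primes_upto_2)
next
  case (Suc i)
  let ?a = "card (primes_upto (2 ^ i))" 
  let ?d = "card (primes_upto (2 ^ Suc i) - primes_upto (2 ^ i))"
  have "card (primes_upto (2 ^ Suc i)) = ?a + ?d"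
    using card_Diff_subset[OF _ primes_upto_mono[of "2^i" "2 ^ Suc i"]] card_mono[OF _ primes_upto_mono[of "2^i" "2 ^ Suc i"]]
    by simp
  moreover have "i * ?d \<le> 2 * 2 ^ i" using card_primes_dyadic[of i] by simp
  ultimately have le: "i * card (primes_upto (2 ^ Suc i)) \<le> 8 * 2 ^ i" using Suc by (simp add: algebra_simps)
  show ?case
  proof (cases "i = 1")
    case True
    have "primes_upto 4 \<subseteq> {2, 3}" 
    proof
      fix p assume "p \<in> primes_upto 4"
      then have p: "prime p" "p \<le> 4" by auto
      moreover have "p \<noteq> 4" using p prime_product[of 2 2] by auto
      ultimately show "p \<in> {2, 3}" using prime_ge_2_nat[of p] by auto
    qed
    then have "card (primes_upto 4) \<le> 2" using card_mono[of "{2,3}" "primes_upto 4"] by simp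
    then show ?thesis using True by simp
  next
    case False
    then have i2: "2 \<le> i" using Suc by simp
    have "2 * Suc i * card (primes_upto (2 ^ Suc i)) \<le> 3 * i * card (primes_upto (2 ^ Suc i))"
      using i2 by (intro mult_right_mono) auto
    then show ?thesis using le unfolding mult.assoc power_Suc by linarith
  qed
qed

text \<open>
  The upper bound has constant 6 and the lower bound constant 1/2, so six halvings (a factor 64)
  leave at most half of the primes below the lower end point.
\<close>
lemma card_primes_between:
  assumes "12 \<le> j"
  shows "2 ^ j \<le> 4 * j * card (primes_upto (2 ^ j) - primes_upto (2 ^ (j - 6)))"
proof -
  define i where "i = j - 6"
  have j: "j = i + 6" "6 \<le> i" using assms by (auto simp: i_def)
  have "card (primes_upto (2 ^ j) - primes_upto (2 ^ i)) = card (primes_upto (2 ^ j)) - card (primes_upto (2 ^ i))"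
    using j by (intro card_Diff_subset primes_upto_mono) auto
  then have eq: "card (primes_upto (2 ^ j)) \<le> card (primes_upto (2 ^ j) - primes_upto (2 ^ i)) + card (primes_upto (2 ^ i))"
    by simp
  have "j * card (primes_upto (2 ^ i)) \<le> 2 * (i * card (primes_upto (2 ^ i)))" using j by simp
  also have "\<dots> \<le> 12 * 2 ^ i" using card_primes_upper[of i] j by simp
  finally have u: "4 * (j * card (primes_upto (2 ^ i))) \<le> 48 * 2 ^ i" by simp
  have l: "2 * 2 ^ j \<le> 4 * (j * card (primes_upto (2 ^ j)))" using card_primes_lower[of j] j(2) unfolding j(1) mult.assoc by linarith
  have "4 * (j * card (primes_upto (2 ^ j))) \<le> 4 * (j * card (primes_upto (2 ^ j) - primes_upto (2 ^ i))) + 4 * (j * card (primes_upto (2 ^ i)))"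
    using mult_left_mono[OF eq, of "4 * j"] by (simp add: algebra_simps)
  moreover have "48 * 2 ^ i \<le> (2::nat) ^ j" by (simp add: j power_add)
  ultimately show ?thesis using u l unfolding i_def by (simp add: mult.assoc)
qed

lemma sum_inverse_squares_le: "(\<Sum>d=1..N. 1 / real d ^ 2) \<le> 2"
proof -
  have "(\<Sum>d=1..Suc N. 1 / real d ^ 2) \<le> 2 - 1 / real (Suc N)" for N
  proof (induction N)
    case (Suc N)
    have "1 / real (Suc (Suc N)) ^ 2 \<le> 1 / (real (Suc N) * real (Suc (Suc N)))"
      unfolding power2_eq_square by (intro divide_left_mono mult_right_mono) auto
    also have "\<dots> = 1 / real (Suc N) - 1 / real (Suc (Suc N))"
      by (simp add: field_simps)
    finally show ?case using Suc by simp
  qed simp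
  from this[of "N - 1"] show ?thesis by (cases N) (auto intro: order_trans)
qed

lemma harmonic_dyadic_lower: "real K / 2 \<le> (\<Sum>n=1..2 ^ K. 1 / real n)"
proof (induction K)
  case (Suc K)
  have "{1..2 ^ Suc K} = {1..2 ^ K} \<union> {2 ^ K <.. (2::nat) ^ Suc K}" by auto
  then have "(\<Sum>n=1..2 ^ Suc K. 1 / real n) = (\<Sum>n=1..2 ^ K. 1 / real n) + (\<Sum>n\<in>{2 ^ K <..2 ^ Suc K}. 1 / real n)"
    by (simp only:) (intro sum.union_disjoint, auto)
  moreover have "(\<Sum>n\<in>{2 ^ K <..(2::nat) ^ Suc K}. 1 / 2 ^ Suc K) \<le> (\<Sum>n\<in>{2 ^ K <..2 ^ Suc K}. 1 / real n)"
  proof (rule sum_mono)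
    fix n assume n: "n \<in> {2 ^ K <..(2::nat) ^ Suc K}"
    then have "real n \<le> 2 ^ Suc K" by (metis greaterThanAtMost_iff of_nat_le_iff of_nat_numeral of_nat_power)
    then show "1 / 2 ^ Suc K \<le> 1 / real n" using n by (intro divide_left_mono) auto
  qed
  moreover have "(\<Sum>n\<in>{2 ^ K <..(2::nat) ^ Suc K}. 1 / 2 ^ Suc K) = (1/2 :: real)"
    by (simp add: field_simps)
  ultimately show ?case using Suc by simp
qed simp

text \<open>
  Every \<open>n\<close> is a square times a squarefree number. The squares contribute a factor of at
  most 2, the squarefree numbers at most the product.
\<close>
lemma prod_primes_ge_harmonic:
  "(\<Sum>n=1..N. 1 / real n) \<le> 2 * (\<Prod>p\<in>primes_upto N. 1 + 1 / real p)"
proof -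
  define sqf :: "nat \<Rightarrow> nat" where "sqf = squarefree_part"
  let ?\<phi> = "\<lambda>n. (square_part n, prime_factors (sqf n))"
  let ?G = "\<lambda>(d, S). 1 / real d ^ 2 * (\<Prod>p\<in>S. 1 / real p)"
  have prod_sqf: "\<Prod>(prime_factors (sqf n)) = sqf n" for n :: nat
  proof -
    have "sqf n = (\<Prod>p\<in>prime_factors (sqf n). p ^ multiplicity p (sqf n))"
      using prod_prime_factors[OF squarefree_part_nonzero, of n] by (simp add: sqf_def)
    also have "\<dots> = \<Prod>(prime_factors (sqf n))"
    proof (intro prod.cong refl)
      fix p assume p: "p \<in> prime_factors (sqf n)"
      then have "0 < multiplicity p (sqf n)" by (simp add: prime_factors_multiplicity)
      moreover have "multiplicity p (sqf n) \<le> Suc 0" using p unfolding sqf_def by auto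
      ultimately have "multiplicity p (sqf n) = 1" by simp
      then show "p ^ multiplicity p (sqf n) = p" by simp
    qed
    finally show ?thesis by simp
  qed
  have dec: "n = sqf n * square_part n ^ 2" for n :: nat unfolding sqf_def by (rule squarefree_decompose)
  have inj: "inj_on ?\<phi> {1..N}"
    by (rule inj_onI) (metis Pair_inject prod_sqf sqf_def squarefree_decomposition_unique)
  have img: "?\<phi> ` {1..N} \<subseteq> {1..N} \<times> Pow (primes_upto N)"
  proof (clarsimp, intro conjI subsetI)
    fix n assume n: "Suc 0 \<le> n" "n \<le> N"
    have s: "0 < square_part n"
    proof (rule ccontr)
      assume "\<not> 0 < square_part n"
      then show False using dec[of n] n by simp
    qed
    then show "Suc 0 \<le> square_part n" by simp
    have "square_part n \<le> square_part n ^ 2" using s by (simp add: power2_eq_square)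
    also have "\<dots> \<le> n" using n by (intro dvd_imp_le) auto
    finally show "square_part n \<le> N" using n by simp
    fix p assume p: "p \<in> prime_factors (sqf n)"
    then have "p dvd sqf n" "prime p" by auto
    moreover have "sqf n dvd n" by (metis dec dvd_triv_left)
    ultimately have "p \<le> n" using n by (intro dvd_imp_le) (auto intro: dvd_trans)
    then show "p \<in> primes_upto N" using n \<open>prime p\<close> by simp
  qed
  have "(\<Sum>n=1..N. 1 / real n) = (\<Sum>n=1..N. ?G (?\<phi> n))"
  proof (rule sum.cong[OF refl])
    fix n
    have "(\<Prod>p\<in>prime_factors (sqf n). 1 / real p) = 1 / real (sqf n)"
    proof -
      have "real (\<Prod>(prime_factors (sqf n))) = real (sqf n)" by (simp only: prod_sqf)
      then show ?thesis by (simp add: prod_dividef)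
    qed
    moreover have "real n = real (sqf n) * real (square_part n) ^ 2"
      using dec[of n] by (metis of_nat_mult of_nat_power)
    ultimately show "1 / real n = ?G (?\<phi> n)" by simp
  qed
  also have "\<dots> = sum ?G (?\<phi> ` {1..N})" using sum.reindex[OF inj, of ?G] by (simp add: o_def)
  also have "\<dots> \<le> sum ?G ({1..N} \<times> Pow (primes_upto N))"
    by (intro sum_mono2 img) (auto intro!: prod_nonneg divide_nonneg_nonneg)
  also have "\<dots> = (\<Sum>d=1..N. 1 / real d ^ 2) * (\<Sum>S\<in>Pow (primes_upto N). \<Prod>p\<in>S. 1 / real p)"
    by (simp only: sum_product sum.cartesian_product)
  also have "\<dots> \<le> 2 * (\<Prod>p\<in>primes_upto N. 1 + 1 / real p)"
    unfolding sum_Pow_prod[OF finite_primes_upto]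
    by (intro mult_right_mono sum_inverse_squares_le prod_nonneg) auto
  finally show ?thesis .
qed

lemma prod_primes_lower: "real K / 4 \<le> (\<Prod>p\<in>primes_upto (2 ^ K). 1 + 1 / real p)"
  using harmonic_dyadic_lower[of K] prod_primes_ge_harmonic[of "2 ^ K"] by simp

lemma exp_recip_primes_lower: "real K / 4 \<le> exp (recip_primes K)"
proof -
  have "(\<Prod>p\<in>primes_upto (2 ^ K). 1 + 1 / real p) \<le> (\<Prod>p\<in>primes_upto (2 ^ K). exp (1 / real p))"
    by (intro prod_mono) (auto simp: exp_ge_add_one_self add.commute)
  then show ?thesis using prod_primes_lower[of K] by (simp add: recip_primes_def exp_sum)
qed

section \<open>Prime factors of x, y and x + y on average\<close>

text \<open>
  The local factor at \<open>p\<close> of \<open>2^(-\<omega>(x)) 2^(-\<omega>(y)) 4^(-\<omega>(x + y))\<close>.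
\<close>
definition form_weight :: "nat \<Rightarrow> nat \<Rightarrow> nat \<Rightarrow> real" where
  "form_weight p x y = (if p dvd x then 1/2 else 1) * (if p dvd y then 1/2 else 1) *
     (if p dvd x + y then 1/4 else 1)"

definition form_defect :: "nat \<Rightarrow> nat \<Rightarrow> nat \<Rightarrow> real" where
  "form_defect p x y = 1 - form_weight p x y"

lemma form_defect_bounds: "0 \<le> form_defect p x y" "form_defect p x y \<le> 1"
  by (auto simp: form_defect_def form_weight_def)

lemma periodic2_form_defect: "periodic2 p (form_defect p)"
proof -
  have "p dvd x + y \<longleftrightarrow> p dvd x mod p + y mod p" for x y
    by (metis dvd_eq_mod_eq_0 mod_add_eq)
  then show ?thesis by (simp add: periodic2_def form_defect_def form_weight_def dvd_mod_iff)
qed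

lemma sum_of_bool_dvd: "0 < (p::nat) \<Longrightarrow> (\<Sum>x<p. of_bool (p dvd x)) = (1::real)"
proof -
  assume p: "0 < p"
  have "(\<Sum>x<p. of_bool (p dvd x)) = (\<Sum>x<p. if x = 0 then 1 else 0::real)"
    by (intro sum.cong refl) (auto dest: nat_dvd_not_less)
  then show ?thesis using p by simp
qed

lemma sum_of_bool_dvd_add:
  assumes "x < (p::nat)" shows "(\<Sum>y<p. of_bool (p dvd x + y)) = (1::real)"
proof -
  have "(\<Sum>y<p. of_bool (p dvd x + y)) = (\<Sum>y<p. if y = (if x = 0 then 0 else p - x) then 1 else 0::real)"
  proof (rule sum.cong[OF refl])
    fix y assume "y \<in> {..<p}"
    have "p dvd x + y \<longleftrightarrow> x + y = 0 \<or> x + y = p"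
    proof
      assume "p dvd x + y"
      then obtain k where k: "x + y = p * k" ..
      have "x + y < p * 2" using \<open>y \<in> {..<p}\<close> assms by simp
      then have lt: "p * k < p * 2" by (simp only: k)
      have "k < 2"
      proof (rule ccontr)
        assume "\<not> k < 2"
        then have "p * 2 \<le> p * k" by (intro mult_left_mono) auto
        then show False using lt by simp
      qed
      then show "x + y = 0 \<or> x + y = p" using k by (auto simp: less_Suc_eq numeral_2_eq_2)
    qed auto
    then show "of_bool (p dvd x + y) = (if y = (if x = 0 then 0 else p - x) then 1 else 0::real)"
      using \<open>y \<in> {..<p}\<close> assms by auto
  qed
  also have "\<dots> = 1" using assms by (subst sum.delta) auto
  finally show ?thesis .
qed

text \<open>
  The three forms lose 1/2, 1/2 and 3/4 on density about \<open>1 / p\<close> each, in total \<open>7/4\<close>. A prime that divides two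
  of them divides all three, which happens for one residue pair only.
\<close>
lemma sum_box_form_defect:
  assumes "0 < p"
  shows "7/4 * real p - 7/4 \<le> sum_box p (form_defect p)" "sum_box p (form_defect p) \<le> 3 * real p"
proof -
  let ?a = "\<lambda>x y. of_bool (p dvd x) :: real" and ?b = "\<lambda>x y. of_bool (p dvd y) :: real"
  let ?c = "\<lambda>x y. of_bool (p dvd x + y) :: real"
  have a: "sum_box p ?a = real p"
    by (simp add: sum_box_def sum_of_bool_dvd[OF assms] flip: sum_distrib_left)
  have b: "sum_box p ?b = real p"
    by (simp add: sum_box_def sum_of_bool_dvd[OF assms])
  have c: "sum_box p ?c = real p"
  proof -
    have "sum_box p ?c = (\<Sum>x<p. 1)"
      unfolding sum_box_def by (intro sum.cong refl sum_of_bool_dvd_add) simp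
    then show ?thesis by simp
  qed
  have ab: "sum_box p (\<lambda>x y. ?a x y * ?b x y) = 1"
    by (simp add: sum_box_def sum_of_bool_dvd[OF assms] flip: sum_distrib_left)
  \<comment> \<open>If \<open>p\<close> divides both \<open>x\<close> and \<open>y\<close>, the right-hand side vanishes.\<close>
  have "sum_box p (form_defect p) \<ge> 
      sum_box p (\<lambda>x y. 1/2 * ?a x y + 1/2 * ?b x y + 3/4 * ?c x y - 7/4 * (?a x y * ?b x y))"
    unfolding sum_box_def form_defect_def form_weight_def
    by (intro sum_mono) (auto simp: dvd_add_right_iff dvd_add_left_iff)
  moreover have "sum_box p (\<lambda>x y. 1/2 * ?a x y + 1/2 * ?b x y + 3/4 * ?c x y - 7/4 * (?a x y * ?b x y))
     = 1/2 * sum_box p ?a + 1/2 * sum_box p ?b + 3/4 * sum_box p ?c - 7/4 * sum_box p (\<lambda>x y. ?a x y * ?b x y)"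
    unfolding sum_box_def by (simp only: sum.distrib sum_subtractf sum_distrib_left)
  ultimately show "7/4 * real p - 7/4 \<le> sum_box p (form_defect p)"
    unfolding a b c ab by simp
  have "sum_box p (form_defect p) \<le> sum_box p (\<lambda>x y. ?a x y + ?b x y + ?c x y)"
    unfolding sum_box_def form_defect_def form_weight_def
    by (intro sum_mono) auto
  also have "\<dots> = sum_box p ?a + sum_box p ?b + sum_box p ?c"
    unfolding sum_box_def by (simp only: sum.distrib)
  finally show "sum_box p (form_defect p) \<le> 3 * real p" unfolding a b c by simp
qed

lemma prod_one_minus_le_exp:
  assumes "finite A" "\<And>p. p \<in> A \<Longrightarrow> g p \<le> (1::real)"
  shows "(\<Prod>p\<in>A. 1 - g p) \<le> exp (- (\<Sum>p\<in>A. g p))"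
proof -
  have "(\<Prod>p\<in>A. 1 - g p) \<le> (\<Prod>p\<in>A. exp (- g p))"
    using assms exp_ge_add_one_self[of "- g _"] by (intro prod_mono) auto
  then show ?thesis using assms by (simp add: exp_sum sum_negf[symmetric])
qed

lemma prod_one_plus_le_exp:
  assumes "finite A" "\<And>p. p \<in> A \<Longrightarrow> 0 \<le> (g p::real)"
  shows "(\<Prod>p\<in>A. 1 + g p) \<le> exp (\<Sum>p\<in>A. g p)"
proof -
  have "(\<Prod>p\<in>A. 1 + g p) \<le> (\<Prod>p\<in>A. exp (g p))"
    using assms by (intro prod_mono) (auto simp: exp_ge_add_one_self add.commute)
  then show ?thesis using assms by (simp add: exp_sum)
qed

lemma sum_inverse_square_primes_le: "(\<Sum>p\<in>primes_upto n. 1 / real p ^ 2) \<le> 2"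
proof -
  have "(\<Sum>p\<in>primes_upto n. 1 / real p ^ 2) \<le> (\<Sum>d=1..n. 1 / real d ^ 2)"
    by (intro sum_mono2) (auto simp: Suc_le_eq prime_gt_0_nat)
  then show ?thesis using sum_inverse_squares_le[of n] by linarith
qed

definition factor_weight :: "nat \<Rightarrow> nat \<Rightarrow> real" where
  "factor_weight x y = (1/2) ^ card (prime_factors x) * (1/2) ^ card (prime_factors y) *
     (1/4) ^ card (prime_factors (x + y))"

lemma prod_if_dvd_ge:
  fixes A :: "nat set"
  assumes "finite A" "\<And>p. p \<in> A \<Longrightarrow> prime p" "0 < x" "0 \<le> c" "c \<le> (1::real)"
  shows "c ^ card (prime_factors x) \<le> (\<Prod>p\<in>A. if p dvd x then c else 1)"
proof -
  have "{p\<in>A. p dvd x} \<subseteq> prime_factors x"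
    using assms(2,3) by (auto intro!: prime_factorsI)
  then have "card {p\<in>A. p dvd x} \<le> card (prime_factors x)" by (intro card_mono) auto
  then have "c ^ card (prime_factors x) \<le> c ^ card {p\<in>A. p dvd x}"
    using assms by (intro power_decreasing) auto
  also have "\<dots> = (\<Prod>p\<in>A. if p dvd x then c else 1)"
    using assms(1) by (simp add: prod.If_cases Int_def)
  finally show ?thesis .
qed

lemma factor_weight_le_prod:
  assumes "finite A" "\<And>p. p \<in> A \<Longrightarrow> prime p" "0 < x" "0 < y"
  shows "factor_weight x y \<le> (\<Prod>p\<in>A. form_weight p x y)"
  unfolding factor_weight_def form_weight_def prod.distrib
  using assms by (intro mult_mono prod_if_dvd_ge mult_nonneg_nonneg prod_nonneg) auto

text \<open>
  The pure sieve with the primes up to \<open>2 ^ W\<close>: products of at most \<open>h\<close> of them are at most \<open>2 ^ (h W)\<close>.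
\<close>
lemma sum_factor_weight_explicit:
  assumes h: "even h" "4 * h * W \<le> K"
  shows "(\<Sum>x\<in>{1..<2^K}. \<Sum>y\<in>{1..<2^K}. factor_weight x y) \<le>
     4 ^ K * (exp (7/2 - 7/4 * recip_primes W) + exp (6 * recip_primes W) / 2 ^ h) + 3 * 2 ^ K * 2 ^ (2 * h * W)"
proof -
  let ?A = "primes_upto (2 ^ W)"
  let ?\<gamma> = "\<lambda>p. sum_box p (form_defect p) / real p ^ 2"
  have fw0: "0 \<le> form_weight p x y" for p x y by (simp add: form_weight_def)
  have "(\<Sum>x\<in>{1..<2^K}. \<Sum>y\<in>{1..<2^K}. factor_weight x y) \<le>
      (\<Sum>x\<in>{1..<2^K}. \<Sum>y\<in>{1..<2^K}. \<Prod>p\<in>?A. form_weight p x y)"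
    by (intro sum_mono factor_weight_le_prod) auto
  also have "\<dots> \<le> (\<Sum>x\<in>{1..<2^K}. \<Sum>y<2^K. \<Prod>p\<in>?A. form_weight p x y)"
    using fw0 by (intro sum_mono sum_mono2 prod_nonneg) auto
  also have "\<dots> \<le> (\<Sum>x<2^K. \<Sum>y<2^K. \<Prod>p\<in>?A. form_weight p x y)"
    using fw0 by (intro sum_mono2 sum_nonneg prod_nonneg) auto
  also have "\<dots> = sum_box (2^K) (\<lambda>x y. \<Prod>p\<in>?A. 1 - form_defect p x y)"
    by (simp add: sum_box_def form_defect_def)
  also have "\<dots> \<le> real (2 ^ K) ^ 2 * ((\<Prod>p\<in>?A. 1 - ?\<gamma> p) + (\<Prod>p\<in>?A. 1 + 2 * ?\<gamma> p) / 2 ^ h) +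
      3 * real (2 ^ K) * real (2 ^ (h * W)) ^ 2"
  proof (rule pure_sieve_box)
    fix S assume S: "S \<subseteq> ?A" "card S \<le> h"
    have "\<Prod>S \<le> (\<Prod>p\<in>S. 2 ^ W)" using S by (intro prod_mono) auto
    also have "\<dots> = 2 ^ (W * card S)" by (simp add: power_mult)
    also have "\<dots> \<le> 2 ^ (h * W)" using S by (intro power_increasing) auto
    finally show "\<Prod>S \<le> 2 ^ (h * W)" .
  next
    have "h * W \<le> K" using h(2) by (simp add: mult.assoc)
    then show "2 ^ (h * W) \<le> (2 ^ K :: nat)" by (intro power_increasing) auto
  qed (auto simp: h form_defect_bounds periodic2_form_defect)
  also have "\<dots> \<le> 4 ^ K * (exp (7/2 - 7/4 * recip_primes W) + exp (6 * recip_primes W) / 2 ^ h) + 3 * 2 ^ K * 2 ^ (2 * h * W)"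
  proof (rule add_mono[OF mult_mono[OF _ add_mono[OF _ divide_right_mono]]])
    have up: "?\<gamma> p \<le> 3 / real p" if "p \<in> ?A" for p
    proof -
      have "0 < p" using that by (auto simp: prime_gt_0_nat)
      then show ?thesis using sum_box_form_defect(2)[of p] by (simp add: divide_simps power2_eq_square)
    qed
    have lo: "7/4 * (1 / real p) - 7/4 * (1 / real p ^ 2) \<le> ?\<gamma> p" if "p \<in> ?A" for p
    proof -
      have "0 < p" using that by (auto simp: prime_gt_0_nat)
      then have "(7/4 * real p - 7/4) / real p ^ 2 \<le> ?\<gamma> p"
        using sum_box_form_defect(1)[of p] by (intro divide_right_mono) auto
      moreover have "(7/4 * real p - 7/4) / real p ^ 2 = 7/4 * (1 / real p) - 7/4 * (1 / real p ^ 2)"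
        using \<open>0 < p\<close> by (simp add: field_simps power2_eq_square)
      ultimately show ?thesis by linarith
    qed
    have le1: "?\<gamma> p \<le> 1" if "p \<in> ?A" for p
    proof -
      have "sum_box p (form_defect p) \<le> sum_box p (\<lambda>x y. 1)"
        unfolding sum_box_def by (intro sum_mono form_defect_bounds)
      then show ?thesis using that by (simp add: sum_box_def power2_eq_square divide_simps)
    qed
    have nn: "0 \<le> ?\<gamma> p" for p unfolding sum_box_def by (intro divide_nonneg_nonneg sum_nonneg form_defect_bounds) auto
    have e: "(\<Prod>p\<in>?A. 1 - ?\<gamma> p) \<le> exp (- (\<Sum>p\<in>?A. ?\<gamma> p))"
      by (intro prod_one_minus_le_exp le1) auto
    have "7/4 * recip_primes W - 7/4 * 2 \<le> (\<Sum>p\<in>?A. ?\<gamma> p)"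
    proof -
      have "(\<Sum>p\<in>?A. 7/4 * (1 / real p) - 7/4 * (1 / real p ^ 2)) \<le> (\<Sum>p\<in>?A. ?\<gamma> p)"
        by (intro sum_mono lo)
      then show ?thesis using sum_inverse_square_primes_le[of "2 ^ W"]
        by (simp only: sum_subtractf sum_distrib_left[symmetric] recip_primes_def)
    qed
    then show "(\<Prod>p\<in>?A. 1 - ?\<gamma> p) \<le> exp (7/2 - 7/4 * recip_primes W)"
      by (intro order_trans[OF e]) simp
    have "(\<Prod>p\<in>?A. 1 + 2 * ?\<gamma> p) \<le> exp (\<Sum>p\<in>?A. 2 * ?\<gamma> p)"
    proof (rule prod_one_plus_le_exp)
      fix p show "0 \<le> 2 * ?\<gamma> p" by (rule mult_nonneg_nonneg[OF _ nn]) simp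
    qed simp
    also have "(\<Sum>p\<in>?A. 2 * ?\<gamma> p) \<le> (\<Sum>p\<in>?A. 6 * (1 / real p))"
    proof (rule sum_mono)
      fix p assume "p \<in> ?A"
      from up[OF this] show "2 * ?\<gamma> p \<le> 6 * (1 / real p)" by linarith
    qed
    also have "\<dots> = 6 * recip_primes W" by (simp add: recip_primes_def sum_distrib_left)
    finally show "(\<Prod>p\<in>?A. 1 + 2 * ?\<gamma> p) \<le> exp (6 * recip_primes W)" by simp
    show "0 \<le> (\<Prod>p\<in>?A. 1 - ?\<gamma> p) + (\<Prod>p\<in>?A. 1 + 2 * ?\<gamma> p) / 2 ^ h"
    proof -
      have "0 \<le> 1 - ?\<gamma> p" if "p \<in> ?A" for p using le1[OF that] by linarith
      then have "0 \<le> (\<Prod>p\<in>?A. 1 - ?\<gamma> p)" by (intro prod_nonneg) auto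
      moreover have "0 \<le> 1 + 2 * ?\<gamma> p" for p using nn[of p] by linarith
      then have "0 \<le> (\<Prod>p\<in>?A. 1 + 2 * ?\<gamma> p)" by (intro prod_nonneg) auto
      then have "0 \<le> (\<Prod>p\<in>?A. 1 + 2 * ?\<gamma> p) / 2 ^ h" by (intro divide_nonneg_nonneg) auto
      ultimately show ?thesis by (rule add_nonneg_nonneg)
    qed
    show "real (2 ^ K) ^ 2 \<le> 4 ^ K" 
    proof -
      have "(2 ^ K)\<^sup>2 = ((2::real) ^ 2) ^ K" by (simp only: power_mult[symmetric] mult.commute)
      then show ?thesis by simp
    qed
    show "3 * real (2 ^ K) * real (2 ^ (h * W)) ^ 2 \<le> 3 * 2 ^ K * 2 ^ (2 * h * W)"
    proof -
      have "(2 ^ (h * W))\<^sup>2 = (2::real) ^ (h * W * 2)" by (simp only: power_mult)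
      also have "h * W * 2 = 2 * h * W" by simp
      finally have "(2 ^ (h * W))\<^sup>2 = (2::real) ^ (2 * h * W)" .
      then show ?thesis by (simp only: of_nat_power of_nat_numeral mult.assoc order_refl)
    qed
  qed auto
  finally show ?thesis .
qed

text \<open>
  The truncation level \<open>h\<close> is a large multiple of \<open>log K\<close>, which makes the error of the truncation
  smaller than the main term, and \<open>W = K / (4 h)\<close> keeps the remainder below \<open>3 * 2^(3 K / 2)\<close>.
  Passing from the primes up to \<open>2 ^ W\<close> to those up to \<open>2 ^ K\<close> then loses a power of \<open>log K\<close>, which
  \<open>K^(1/100)\<close> dominates.
\<close>
proposition sum_factor_weight_asymptotic:
  obtains C where "0 < C" "\<forall>\<^sub>F K in sequentially. 
     (\<Sum>x\<in>{1..<2^K}. \<Sum>y\<in>{1..<2^K}. factor_weight x y) \<le>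
       C * 4 ^ K * (real K powr (1/100) * exp (- (7/4) * recip_primes K))"
proof
  let ?C = "exp 7 + exp 24 + 1 :: real"
  define h where "h = (\<lambda>K::nat. 2 * nat \<lceil>20 * ln (real K)\<rceil>)"
  show "0 < ?C" by (intro add_pos_pos) auto
  have e1: "\<forall>\<^sub>F K in sequentially. 4 * (40 * ln (real K) + 2) \<le> real K" by real_asymp
  have e2: "\<forall>\<^sub>F K in sequentially. exp (7/2 * ln (8 * (40 * ln (real K) + 2))) \<le> real K powr (1/100)" by real_asymp
  have e3: "\<forall>\<^sub>F K in sequentially. 3 * 2 powr (- (real K / 2)) \<le> exp (- 21/4 - 7/2 * ln (real K))" by real_asymp
  show "\<forall>\<^sub>F K in sequentially. 
     (\<Sum>x\<in>{1..<2^K}. \<Sum>y\<in>{1..<2^K}. factor_weight x y) \<le>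
       ?C * 4 ^ K * (real K powr (1/100) * exp (- (7/4) * recip_primes K))"
    using e1 e2 e3 eventually_ge_at_top[of 3]
  proof eventually_elim
    case (elim K)
    define H where "H = h K"
    define W where "W = K div (4 * H)"
    let ?m = "exp (- (7/4) * recip_primes K)"
    let ?k = "real K powr (1/100)"
    have K: "3 \<le> K" by fact
    have lnK: "0 < ln (real K)" using K by simp
    have H1: "40 * ln (real K) \<le> real H" using lnK unfolding H_def h_def by linarith
    have H2: "real H \<le> 40 * ln (real K) + 2" using lnK unfolding H_def h_def by linarith
    have H0: "0 < H" using H1 lnK by linarith
    have "real (4 * H) \<le> real K" using elim(1) H2 by simp
    then have "4 * H \<le> K" by linarith
    then have W0: "0 < W" using H0 by (simp add: W_def div_greater_zero_iff)
    have WK: "4 * H * W \<le> K" by (simp add: W_def)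
    have "W \<le> 4 * H * W" using H0 by simp
    then have WK': "W \<le> K" using WK by linarith
    have "K < (W + 1) * (4 * H)" unfolding W_def using H0 dividend_less_div_times[of "4 * H" K] by simp
    also have "\<dots> \<le> (W + W) * (4 * H)" using W0 by (intro mult_right_mono) auto
    finally have "K \<le> 8 * H * W" by (simp add: algebra_simps)
    then have KW: "real K / real W \<le> 8 * real H"
      using W0 by (simp add: pos_divide_le_eq) (metis of_nat_le_iff of_nat_mult of_nat_numeral)
    have main: "(\<Sum>x\<in>{1..<2^K}. \<Sum>y\<in>{1..<2^K}. factor_weight x y) \<le>
     4 ^ K * (exp (7/2 - 7/4 * recip_primes W) + exp (6 * recip_primes W) / 2 ^ H) + 3 * 2 ^ K * 2 ^ (2 * H * W)"
      by (rule sum_factor_weight_explicit) (use WK in \<open>auto simp: H_def h_def\<close>)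
    have k1: "1 \<le> ?k" using K by (intro ge_one_powr_ge_zero) auto
    have mlow: "exp (- 21/4 - 7/2 * ln (real K)) \<le> ?m"
      using recip_primes_upper[of K] K by simp
    have a: "exp (7/2 - 7/4 * recip_primes W) \<le> exp 7 * (?k * ?m)"
    proof -
      have "ln (real K / real W) \<le> ln (8 * (40 * ln (real K) + 2))"
      proof -
        have "real K / real W \<le> 8 * (40 * ln (real K) + 2)" using H2 by (intro order_trans[OF KW]) simp
        moreover have "0 < real K / real W" using W0 K by simp
        ultimately show ?thesis by (intro ln_mono) auto
      qed
      moreover have "recip_primes K \<le> recip_primes W + 2 + 2 * ln (real K / real W)"
        by (rule recip_primes_increment[OF W0 WK'])
      ultimately have "exp (7/2 - 7/4 * recip_primes W) \<le> 
          exp (7 + 7/2 * ln (8 * (40 * ln (real K) + 2)) + - (7/4) * recip_primes K)" by simp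
      also have "\<dots> = exp 7 * (exp (7/2 * ln (8 * (40 * ln (real K) + 2))) * ?m)"
        by (simp only: exp_add mult.assoc)
      also have "\<dots> \<le> exp 7 * (?k * ?m)"
        using elim(2) by (intro mult_left_mono mult_right_mono) auto
      finally show ?thesis .
    qed
    have b: "exp (6 * recip_primes W) / 2 ^ H \<le> exp 24 * (?k * ?m)"
    proof -
      have "exp (20 * ln (real K)) \<le> exp (real H * (1/2))" using H1 by simp
      also have "\<dots> = exp (1/2) ^ H" by (rule exp_of_nat_mult)
      also have "\<dots> \<le> 2 ^ H" using exp_half_le2 by (intro power_mono) auto
      finally have "exp (6 * recip_primes W) / 2 ^ H \<le> exp (6 * recip_primes W) / exp (20 * ln (real K))"
        by (intro divide_left_mono) auto
      also have "\<dots> = exp (6 * recip_primes W - 20 * ln (real K))" by (simp add: exp_diff)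
      also have "\<dots> \<le> exp (24 + (- 21/4 - 7/2 * ln (real K)))"
      proof -
        have "recip_primes K \<le> 3 + 2 * ln (real K)" using K by (intro recip_primes_upper) simp
        then have "6 * recip_primes W - 20 * ln (real K) \<le> 24 + (- 21/4 - 7/2 * ln (real K))"
          using recip_primes_mono[OF WK'] lnK by linarith
        then show ?thesis by (simp only: exp_le_cancel_iff)
      qed
      also have "\<dots> \<le> exp 24 * ?m" using mlow by (simp only: exp_add) simp
      also have "\<dots> \<le> exp 24 * (?k * ?m)" using k1 by (intro mult_left_mono) auto
      finally show ?thesis .
    qed
    have c: "3 * 2 ^ K * 2 ^ (2 * H * W) \<le> 4 ^ K * (?k * ?m)"
    proof -
      have pK: "(2::real) ^ K = 2 powr real K" by (rule powr_realpow[symmetric]) simp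
      have "real (4 * H * W) \<le> real K" using WK by (simp only: of_nat_le_iff)
      then have HW: "real (2 * H * W) \<le> real K - real K / 2" by simp
      have "(2::real) ^ (2 * H * W) = 2 powr real (2 * H * W)" by (rule powr_realpow[symmetric]) simp
      also have "\<dots> \<le> 2 powr (real K - real K / 2)" using HW by (rule powr_mono) simp
      also have "\<dots> = 2 ^ K * 2 powr (- (real K / 2))"
        unfolding pK powr_add[symmetric] by (simp only: diff_conv_add_uminus)
      finally have D: "2 ^ (2 * H * W) \<le> 2 ^ K * (2::real) powr (- (real K / 2))" .
      have "3 * 2 ^ K * 2 ^ (2 * H * W) \<le> 3 * 2 ^ K * (2 ^ K * (2::real) powr (- (real K / 2)))"
        by (rule mult_left_mono[OF D]) simp
      also have "\<dots> = 4 ^ K * (3 * 2 powr (- (real K / 2)))"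
      proof -
        have "(4::real) ^ K = 2 ^ K * 2 ^ K" unfolding power_mult_distrib[symmetric] by simp
        then show ?thesis by (simp only: mult_ac)
      qed
      also have "\<dots> \<le> 4 ^ K * ?m" by (rule mult_left_mono[OF order_trans[OF elim(3) mlow]]) simp
      also have "\<dots> \<le> 4 ^ K * (?k * ?m)" using k1 by (intro mult_left_mono) auto
      finally show ?thesis .
    qed
    have "4 ^ K * (exp (7/2 - 7/4 * recip_primes W) + exp (6 * recip_primes W) / 2 ^ H) + 3 * 2 ^ K * 2 ^ (2 * H * W)
      \<le> 4 ^ K * (exp 7 * (?k * ?m) + exp 24 * (?k * ?m)) + 4 ^ K * (?k * ?m)"
      by (rule add_mono[OF mult_left_mono[OF add_mono[OF a b]] c]) simp
    also have "\<dots> = ?C * 4 ^ K * (?k * ?m)"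
    proof -
      have "c * (a * X + b * X) + c * X = (a + b + 1) * c * X" for a b c X :: real
        by (simp add: algebra_simps)
      then show ?thesis .
    qed
    finally show ?case by (rule order_trans[OF main])
  qed
qed

section \<open>Squarefree integers weighted by their reciprocals\<close>

definition recip_mass :: "nat set \<Rightarrow> real" where
  "recip_mass S = (\<Prod>p\<in>S. 1 / real p)"

definition total_mass :: "nat set \<Rightarrow> real" where
  "total_mass Q = (\<Prod>p\<in>Q. 1 + 1 / real p)"

lemma recip_mass_nonneg: "0 \<le> recip_mass S"
  unfolding recip_mass_def by (intro prod_nonneg) auto

lemma total_mass_pos: "0 < total_mass Q"
  unfolding total_mass_def by (intro prod_pos) (auto intro: add_pos_nonneg)

lemma sum_recip_mass: "finite Q \<Longrightarrow> (\<Sum>S\<in>Pow Q. recip_mass S) = total_mass Q"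
  unfolding recip_mass_def total_mass_def by (rule sum_Pow_prod)

text \<open>
  Exponential moment of the number of prime factors in \<open>R\<close>: under the weights \<open>1/k\<close> a prime \<open>p\<close> divides
  \<open>k\<close> with probability close to \<open>1/p\<close>; the summand 2 absorbs the squares \<open>1/p\<^sup>2\<close>.
\<close>
lemma prod_weighted_le:
  assumes Q: "finite Q" "\<And>p. p \<in> Q \<Longrightarrow> prime p" and R: "R \<subseteq> Q" and q: "0 \<le> q"
  shows "(\<Prod>p\<in>Q. 1 + (if p \<in> R then q else 1) * (1 / real p)) \<le>
    exp (2 + (q - 1) * (\<Sum>p\<in>R. 1 / real p)) * total_mass Q"
proof -
  have factor: "1 + q * u \<le> (1 + u) * exp ((q - 1) * u + u ^ 2)" if "0 \<le> u" for u :: real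
  proof -
    have "0 \<le> q * u ^ 2 + u ^ 3" using q that by simp
    then have "1 + q * u \<le> (1 + u) * (1 + ((q - 1) * u + u ^ 2))"
      by (simp add: algebra_simps power2_eq_square power3_eq_cube)
    also have "\<dots> \<le> (1 + u) * exp ((q - 1) * u + u ^ 2)"
      using that by (intro mult_left_mono exp_ge_add_one_self) auto
    finally show ?thesis .
  qed
  let ?e = "\<lambda>p. (q - 1) * (1 / real p) + 1 / real p ^ 2"
  have finR: "finite R" using Q R finite_subset by blast
  have "(\<Prod>p\<in>Q. 1 + (if p \<in> R then q else 1) * (1 / real p)) \<le>
     (\<Prod>p\<in>Q. (1 + 1 / real p) * (if p \<in> R then exp (?e p) else 1))"
  proof (rule prod_mono, rule conjI)
    fix p assume "p \<in> Q"
    show "0 \<le> 1 + (if p \<in> R then q else 1) * (1 / real p)" using q by simp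
    show "1 + (if p \<in> R then q else 1) * (1 / real p) \<le> (1 + 1 / real p) * (if p \<in> R then exp (?e p) else 1)"
      using factor[of "1 / real p"] by (simp add: power_one_over)
  qed
  also have "\<dots> = total_mass Q * (\<Prod>p\<in>R. exp (?e p))"
    using Q R by (simp add: prod.distrib total_mass_def prod.If_cases Int_absorb1)
  also have "(\<Prod>p\<in>R. exp (?e p)) = exp ((q - 1) * (\<Sum>p\<in>R. 1 / real p) + (\<Sum>p\<in>R. 1 / real p ^ 2))"
    by (simp only: exp_sum[OF finR, symmetric] sum.distrib sum_distrib_left)
  also have "(\<Sum>p\<in>R. 1 / real p ^ 2) \<le> 2"
  proof -
    have "R \<subseteq> primes_upto (Max R)" using finR Q R by auto
    then have "(\<Sum>p\<in>R. 1 / real p ^ 2) \<le> (\<Sum>p\<in>primes_upto (Max R). 1 / real p ^ 2)"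
      by (intro sum_mono2) auto
    then show ?thesis using sum_inverse_square_primes_le[of "Max R"] by linarith
  qed
  finally have "(\<Prod>p\<in>Q. 1 + (if p \<in> R then q else 1) * (1 / real p)) \<le>
      total_mass Q * exp ((q - 1) * (\<Sum>p\<in>R. 1 / real p) + 2)"
    using total_mass_pos[of Q] by simp
  then show ?thesis by (simp only: mult.commute add.commute)
qed

lemma sum_weighted_recip_mass_le:
  assumes Q: "finite Q" "\<And>p. p \<in> Q \<Longrightarrow> prime p" and R: "R \<subseteq> Q" and q: "0 \<le> q"
  shows "(\<Sum>S\<in>Pow Q. q ^ card (S \<inter> R) * recip_mass S) \<le>
    exp (2 + (q - 1) * (\<Sum>p\<in>R. 1 / real p)) * total_mass Q"
proof -
  have "(\<Sum>S\<in>Pow Q. q ^ card (S \<inter> R) * recip_mass S) = 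
        (\<Sum>S\<in>Pow Q. \<Prod>p\<in>S. (if p \<in> R then q else 1) * (1 / real p))"
  proof (rule sum.cong[OF refl])
    fix S assume "S \<in> Pow Q"
    then have "finite S" using Q finite_subset by blast
    then have "(\<Prod>p\<in>S. if p \<in> R then q else 1) = q ^ card (S \<inter> R)"
      by (simp add: prod.If_cases)
    then show "q ^ card (S \<inter> R) * recip_mass S = (\<Prod>p\<in>S. (if p \<in> R then q else 1) * (1 / real p))"
      unfolding prod.distrib recip_mass_def by simp
  qed
  also have "\<dots> = (\<Prod>p\<in>Q. 1 + (if p \<in> R then q else 1) * (1 / real p))"
    by (rule sum_Pow_prod[OF Q(1)])
  finally show ?thesis using prod_weighted_le[OF assms] by simp
qed

lemma sum_supersets_prod:
  fixes f :: "'a \<Rightarrow> real"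
  assumes "finite Q" "D \<subseteq> Q"
  shows "(\<Sum>S | S \<subseteq> Q \<and> D \<subseteq> S. \<Prod>p\<in>S. f p) = (\<Prod>p\<in>D. f p) * (\<Prod>p\<in>Q - D. 1 + f p)"
proof -
  have fin: "finite D" using assms finite_subset by blast
  have eq: "{S. S \<subseteq> Q \<and> D \<subseteq> S} = (\<lambda>S. D \<union> S) ` Pow (Q - D)"
  proof (rule equalityI; rule subsetI)
    fix S assume "S \<in> {S. S \<subseteq> Q \<and> D \<subseteq> S}"
    then have "S = D \<union> (S - D)" "S - D \<in> Pow (Q - D)" by auto
    then show "S \<in> (\<lambda>S. D \<union> S) ` Pow (Q - D)" by (rule image_eqI)
  qed (use assms in auto)
  have inj: "inj_on (\<lambda>S. D \<union> S) (Pow (Q - D))" by (auto simp: inj_on_def)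
  have "(\<Sum>S | S \<subseteq> Q \<and> D \<subseteq> S. \<Prod>p\<in>S. f p) = (\<Sum>S\<in>Pow (Q - D). \<Prod>p\<in>D \<union> S. f p)"
    unfolding eq sum.reindex[OF inj] by (simp add: o_def)
  also have "\<dots> = (\<Sum>S\<in>Pow (Q - D). (\<Prod>p\<in>D. f p) * (\<Prod>p\<in>S. f p))"
  proof (rule sum.cong[OF refl])
    fix S assume S: "S \<in> Pow (Q - D)"
    then have "finite S" using assms finite_subset[of S Q] by blast
    then show "(\<Prod>p\<in>D \<union> S. f p) = (\<Prod>p\<in>D. f p) * (\<Prod>p\<in>S. f p)"
      using S fin by (intro prod.union_disjoint) auto
  qed
  also have "\<dots> = (\<Prod>p\<in>D. f p) * (\<Prod>p\<in>Q - D. 1 + f p)"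
    unfolding sum_distrib_left[symmetric] by (subst sum_Pow_prod) (use assms in auto)
  finally show ?thesis .
qed

text \<open>
  Rankin's trick: under the restriction on the number of primes the factor
  \<open>4 powr b * (1/4) ^ card (S \<inter> R)\<close> is at least 1, and with this factor inserted the sum becomes a product.
\<close>
lemma mass_supersets_few_primes_le:
  assumes Q: "finite Q" "\<And>p. p \<in> Q \<Longrightarrow> prime p" and R: "D \<subseteq> R" "R \<subseteq> Q"
  shows "(\<Sum>S | S \<subseteq> Q \<and> D \<subseteq> S \<and> real (card (S \<inter> R)) \<le> b. recip_mass S) \<le>
     4 powr b * ((1/4) ^ card D * recip_mass D) * (exp (2 - 3/4 * (\<Sum>p\<in>R. 1 / real p)) * total_mass Q)"
proof -
  let ?f = "\<lambda>p. (if p \<in> R then 1/4 else 1) * (1 / real p)"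
  have fin: "finite {S. S \<subseteq> Q \<and> D \<subseteq> S}"
    by (rule finite_subset[of _ "Pow Q"]) (use Q(1) in auto)
  have finD: "finite D" by (rule finite_subset[OF order_trans[OF R] Q(1)])
  have pf: "(\<Prod>p\<in>S. ?f p) = (1/4) ^ card (S \<inter> R) * recip_mass S" if "S \<subseteq> Q" for S
  proof -
    have "finite S" by (rule finite_subset[OF that Q(1)])
    then have "(\<Prod>p\<in>S. if p \<in> R then 1/4 else 1) = (1/4 :: real) ^ card (S \<inter> R)"
      by (simp add: prod.If_cases)
    then show ?thesis unfolding prod.distrib recip_mass_def by simp
  qed
  have "(\<Sum>S | S \<subseteq> Q \<and> D \<subseteq> S \<and> real (card (S \<inter> R)) \<le> b. recip_mass S) \<le>
     (\<Sum>S | S \<subseteq> Q \<and> D \<subseteq> S \<and> real (card (S \<inter> R)) \<le> b. 4 powr b * (\<Prod>p\<in>S. ?f p))"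
  proof (rule sum_mono)
    fix S assume S: "S \<in> {S. S \<subseteq> Q \<and> D \<subseteq> S \<and> real (card (S \<inter> R)) \<le> b}"
    have "4 powr real (card (S \<inter> R)) \<le> (4::real) powr b" using S by (intro powr_mono) auto
    then have "(4::real) ^ card (S \<inter> R) \<le> 4 powr b" by (simp add: powr_realpow)
    then have "1 \<le> 4 powr b * (1/4) ^ card (S \<inter> R)" by (simp add: power_one_over divide_simps)
    then have "1 * recip_mass S \<le> 4 powr b * (1/4) ^ card (S \<inter> R) * recip_mass S"
      by (rule mult_right_mono[OF _ recip_mass_nonneg])
    then show "recip_mass S \<le> 4 powr b * (\<Prod>p\<in>S. ?f p)" using S by (subst pf) (auto simp: mult.assoc)
  qed
  also have "\<dots> \<le> (\<Sum>S | S \<subseteq> Q \<and> D \<subseteq> S. 4 powr b * (\<Prod>p\<in>S. ?f p))"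
    by (intro sum_mono2 fin mult_nonneg_nonneg prod_nonneg) auto
  also have "\<dots> = 4 powr b * ((\<Prod>p\<in>D. ?f p) * (\<Prod>p\<in>Q - D. 1 + ?f p))"
    unfolding sum_distrib_left[symmetric] by (subst sum_supersets_prod) (use Q R in auto)
  also have "(\<Prod>p\<in>D. ?f p) = (1/4) ^ card D * recip_mass D"
    using pf[of D] R by (simp add: Int_absorb2)
  also have "4 powr b * ((1/4) ^ card D * recip_mass D * (\<Prod>p\<in>Q - D. 1 + ?f p)) \<le>
     4 powr b * ((1/4) ^ card D * recip_mass D * (exp (2 - 3/4 * (\<Sum>p\<in>R. 1 / real p)) * total_mass Q))"
  proof (intro mult_left_mono)
    have "(\<Prod>p\<in>Q - D. 1 + ?f p) \<le> (\<Prod>p\<in>Q. 1 + ?f p)"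
      by (intro prod_mono2 Q) auto
    also have "\<dots> \<le> exp (2 + (1/4 - 1) * (\<Sum>p\<in>R. 1 / real p)) * total_mass Q"
      by (rule prod_weighted_le) (use Q R in auto)
    finally show "(\<Prod>p\<in>Q - D. 1 + ?f p) \<le> exp (2 - 3/4 * (\<Sum>p\<in>R. 1 / real p)) * total_mass Q"
      by simp
  qed (auto simp: recip_mass_nonneg)
  finally show ?thesis by (simp only: mult.assoc)
qed

lemma sum_le_sum_cover:
  fixes f :: "'a \<Rightarrow> real"
  assumes "finite I" "\<And>i. i \<in> I \<Longrightarrow> finite (E i)" "B \<subseteq> (\<Union>i\<in>I. E i)" "\<And>x. 0 \<le> f x"
  shows "sum f B \<le> (\<Sum>i\<in>I. sum f (E i))"
proof -
  have "sum f (\<Union>i\<in>I. E i) \<le> (\<Sum>i\<in>I. sum f (E i))"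
    using assms(1,2)
  proof (induction I rule: finite_induct)
    case (insert a I)
    have "sum f (E a \<union> (\<Union>i\<in>I. E i)) + sum f (E a \<inter> (\<Union>i\<in>I. E i)) = sum f (E a) + sum f (\<Union>i\<in>I. E i)"
      using insert by (intro sum.union_inter) auto
    moreover have "0 \<le> sum f (E a \<inter> (\<Union>i\<in>I. E i))" using assms(4) by (intro sum_nonneg)
    ultimately show ?case using insert by simp
  qed simp
  moreover have "sum f B \<le> sum f (\<Union>i\<in>I. E i)" using assms by (intro sum_mono2) auto
  ultimately show ?thesis by simp
qed

definition recip_sum :: "nat set \<Rightarrow> real" where
  "recip_sum R = (\<Sum>p\<in>R. 1 / real p)"

text \<open>
  The reciprocal sum of a segment of \<open>Q\<close> is, up to the squares \<open>1/p\<^sup>2\<close>, the expected number of its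
  elements in a random \<open>S\<close>; the slack \<open>c\<close> allows for the short segments.
\<close>
definition irregular :: "nat \<Rightarrow> nat set \<Rightarrow> nat set \<Rightarrow> bool" where
  "irregular c Q S \<longleftrightarrow> (\<exists>K::nat. real (card (S \<inter> (Q \<inter> {..2 ^ K}))) > 
     21/20 * (recip_sum (Q \<inter> {..2 ^ K}) + 1) + real c)"

lemma ln_21_20: "477/10000 \<le> ln (21/20 :: real)"
proof -
  have "exp (477/10000 :: real) \<le> 1 + 477/10000 + (477/10000)\<^sup>2" by (rule exp_bound) auto
  also have "\<dots> \<le> 21/20" by (simp add: power2_eq_square)
  finally show ?thesis by (subst ln_ge_iff) auto
qed

text \<open>
  One exponential moment bounds the failure at a single scale by a quantity decaying exponentially
  in the expected number of primes. To avoid summing over all \<open>K\<close>, the segments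
  are grouped by the integer \<open>j\<close> just above that expectation: each of them lies in the largest initial segment \<open>R j\<close>
  whose reciprocals sum to at most \<open>j\<close>.
\<close>
proposition irregular_mass:
  obtains c where "\<And>Q. finite Q \<Longrightarrow> (\<And>p. p \<in> Q \<Longrightarrow> prime p) \<Longrightarrow> 
    (\<Sum>S | S \<subseteq> Q \<and> irregular c Q S. recip_mass S) \<le> 1/4 * total_mass Q"
proof -
  \<comment> \<open>The rate \<open>17/200000 = 21/20 * 477/10000 - 1/20\<close> is positive because \<open>ln (21/20) > 1/21\<close>.\<close>
  define \<rho> where "\<rho> = exp (- 17/200000 :: real)"
  have \<rho>: "0 < \<rho>" "\<rho> < 1" by (auto simp: \<rho>_def)
  \<comment> \<open>The geometric series over \<open>j\<close> is bounded independently of \<open>Q\<close>, so a constant excess \<open>c\<close> suffices.\<close>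
  obtain c :: nat where c: "4 * (exp 2 / (1 - \<rho>)) < (21/20) ^ c"
    using real_arch_pow[of "21/20" "4 * (exp 2 / (1 - \<rho>))"] by auto
  show thesis
  proof (rule that[of c])
    fix Q :: "nat set" assume Q: "finite Q" "\<And>p. p \<in> Q \<Longrightarrow> prime p"
    \<comment> \<open>The largest initial segment of \<open>Q\<close> with reciprocal sum at most \<open>j\<close>.\<close>
    define R where "R = (\<lambda>j::nat. {p \<in> Q. recip_sum (Q \<inter> {..p}) \<le> real j})"
    define J where "J = nat \<lceil>recip_sum Q\<rceil>"
    let ?E = "\<lambda>j. {S. S \<subseteq> Q \<and> real (card (S \<inter> R j)) > 21/20 * real j + real c}"
    have mono: "recip_sum A \<le> recip_sum B" if "A \<subseteq> B" "B \<subseteq> Q" for A B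
      unfolding recip_sum_def using that Q finite_subset by (intro sum_mono2) auto
    have nn: "0 \<le> recip_sum A" for A unfolding recip_sum_def by (intro sum_nonneg) auto
    have RQ: "R j \<subseteq> Q" for j by (auto simp: R_def)
    have finR: "finite (R j)" for j using RQ Q finite_subset by blast
    have sumR: "recip_sum (R j) \<le> real j" for j
    proof (cases "R j = {}")
      case False
      have "recip_sum (R j) \<le> recip_sum (Q \<inter> {..Max (R j)})"
        using finR[of j] RQ by (intro mono) auto
      also have "\<dots> \<le> real j" using Max_in[OF finR[of j] False] by (auto simp: R_def)
      finally show ?thesis .
    qed (simp add: recip_sum_def)
    have cover: "{S. S \<subseteq> Q \<and> irregular c Q S} \<subseteq> (\<Union>j\<in>{..J}. ?E j)"
    proof
      fix S assume "S \<in> {S. S \<subseteq> Q \<and> irregular c Q S}"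
      then obtain K :: nat where S: "S \<subseteq> Q" and 
        K: "real (card (S \<inter> (Q \<inter> {..2 ^ K}))) > 21/20 * (recip_sum (Q \<inter> {..2 ^ K}) + 1) + real c"
        by (auto simp: irregular_def)
      define j where "j = nat \<lceil>recip_sum (Q \<inter> {..2 ^ K})\<rceil>"
      have j1: "recip_sum (Q \<inter> {..2 ^ K}) \<le> real j" unfolding j_def by linarith
      have j2: "real j \<le> recip_sum (Q \<inter> {..2 ^ K}) + 1" unfolding j_def using nn[of "Q \<inter> {..2 ^ K}"] by linarith
      have "recip_sum (Q \<inter> {..2 ^ K}) \<le> recip_sum Q" by (intro mono) auto
      then have "j \<le> J" unfolding j_def J_def by (intro nat_mono ceiling_mono)
      have sub: "Q \<inter> {..2 ^ K} \<subseteq> R j"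
      proof
        fix p assume p: "p \<in> Q \<inter> {..2 ^ K}"
        then have "recip_sum (Q \<inter> {..p}) \<le> recip_sum (Q \<inter> {..2 ^ K})" by (intro mono) auto
        then show "p \<in> R j" using p j1 by (auto simp: R_def)
      qed
      have "card (S \<inter> (Q \<inter> {..2 ^ K})) \<le> card (S \<inter> R j)"
        using sub finR[of j] by (intro card_mono) auto
      then have "real (card (S \<inter> (Q \<inter> {..2 ^ K}))) \<le> real (card (S \<inter> R j))" by (rule of_nat_mono)
      moreover have "21/20 * real j \<le> 21/20 * (recip_sum (Q \<inter> {..2 ^ K}) + 1)" using j2 by simp
      ultimately have "real (card (S \<inter> R j)) > 21/20 * real j + real c" using K by linarith
      then show "S \<in> (\<Union>j\<in>{..J}. ?E j)" using \<open>j \<le> J\<close> S by auto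
    qed
    have each: "(\<Sum>S\<in>?E j. recip_mass S) \<le> exp 2 / (21/20) ^ c * total_mass Q * \<rho> ^ j" for j
    proof -
      let ?t = "21/20 * real j + real c"
      have "(\<Sum>S\<in>?E j. recip_mass S) \<le> (\<Sum>S\<in>?E j. (21/20) powr (- ?t) * ((21/20) ^ card (S \<inter> R j) * recip_mass S))"
      proof (rule sum_mono)
        fix S assume S: "S \<in> ?E j"
        have "1 = (21/20) powr (- ?t) * (21/20 :: real) powr ?t" by (simp add: powr_add[symmetric])
        also have "\<dots> \<le> (21/20) powr (- ?t) * (21/20) powr real (card (S \<inter> R j))"
          using S by (intro mult_left_mono powr_mono) auto
        also have "(21/20 :: real) powr real (card (S \<inter> R j)) = (21/20) ^ card (S \<inter> R j)"
          by (rule powr_realpow) simp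
        finally have "1 * recip_mass S \<le> (21/20) powr (- ?t) * (21/20) ^ card (S \<inter> R j) * recip_mass S"
          by (rule mult_right_mono[OF _ recip_mass_nonneg])
        then show "recip_mass S \<le> (21/20) powr (- ?t) * ((21/20) ^ card (S \<inter> R j) * recip_mass S)"
          by (simp only: mult.assoc mult_1)
      qed
      also have "\<dots> \<le> (\<Sum>S\<in>Pow Q. (21/20) powr (- ?t) * ((21/20) ^ card (S \<inter> R j) * recip_mass S))"
        using Q by (intro sum_mono2 mult_nonneg_nonneg recip_mass_nonneg) auto
      also have "\<dots> \<le> (21/20) powr (- ?t) * (exp (2 + (21/20 - 1) * recip_sum (R j)) * total_mass Q)"
        unfolding sum_distrib_left[symmetric] recip_sum_def
        by (intro mult_left_mono sum_weighted_recip_mass_le Q RQ) auto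
      also have "\<dots> \<le> (21/20) powr (- ?t) * (exp (2 + 1/20 * real j) * total_mass Q)"
        using sumR[of j] total_mass_pos[of Q] by (intro mult_left_mono mult_right_mono) auto
      also have "(21/20 :: real) powr (- ?t) \<le> exp (- (1/20 + 17/200000) * real j) / (21/20) ^ c"
      proof -
        have "(21/20 :: real) powr (- ?t) = (21/20) powr (- (21/20 * real j)) * (21/20) powr (- real c)"
          unfolding powr_add[symmetric] by simp
        also have "(21/20 :: real) powr (- real c) = 1 / (21/20) ^ c"
          by (simp add: powr_minus powr_realpow divide_simps)
        also have "(21/20 :: real) powr (- (21/20 * real j)) = exp (- (21/20 * real j * ln (21/20)))"
          by (simp add: powr_def)
        also have "\<dots> \<le> exp (- (1/20 + 17/200000) * real j)"
        proof -
          have "(1/20 + 17/200000) * real j = 21/20 * real j * (477/10000)" by simp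
          also have "\<dots> \<le> 21/20 * real j * ln (21/20)" by (intro mult_left_mono ln_21_20) auto
          finally show ?thesis by simp
        qed
        finally show ?thesis by (simp add: divide_simps)
      qed
      also have "exp (- (1/20 + 17/200000) * real j) / (21/20) ^ c * (exp (2 + 1/20 * real j) * total_mass Q)
         = exp 2 / (21/20) ^ c * total_mass Q * \<rho> ^ j"
      proof -
        have "exp (- (1/20 + 17/200000) * real j) * exp (2 + 1/20 * real j) = exp 2 * exp (real j * (- 17/200000))"
          by (simp add: exp_add[symmetric] algebra_simps)
        also have "exp (real j * (- 17/200000)) = \<rho> ^ j" unfolding \<rho>_def by (rule exp_of_nat_mult)
        finally show ?thesis by (simp add: divide_simps mult_ac)
      qed
      finally show ?thesis using total_mass_pos[of Q] by simp
    qed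
    have "(\<Sum>S | S \<subseteq> Q \<and> irregular c Q S. recip_mass S) \<le> (\<Sum>j\<le>J. \<Sum>S\<in>?E j. recip_mass S)"
      using Q by (intro sum_le_sum_cover cover recip_mass_nonneg) auto
    also have "\<dots> \<le> (\<Sum>j\<le>J. exp 2 / (21/20) ^ c * total_mass Q * \<rho> ^ j)"
      by (intro sum_mono each)
    also have "\<dots> = exp 2 / (21/20) ^ c * total_mass Q * (\<Sum>j\<le>J. \<rho> ^ j)"
      by (simp add: sum_distrib_left)
    also have "\<dots> \<le> exp 2 / (21/20) ^ c * total_mass Q * (1 / (1 - \<rho>))"
    proof (intro mult_left_mono)
      have "(\<Sum>j\<le>J. \<rho> ^ j) = (1 - \<rho> ^ Suc J) / (1 - \<rho>)"
        using sum_gp_basic[of \<rho> J] \<rho> by (simp add: field_simps)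
      also have "\<dots> \<le> 1 / (1 - \<rho>)" using \<rho> by (intro divide_right_mono) auto
      finally show "(\<Sum>j\<le>J. \<rho> ^ j) \<le> 1 / (1 - \<rho>)" .
    qed (use total_mass_pos[of Q] in auto)
    also have "\<dots> = (exp 2 / (1 - \<rho>)) / (21/20) ^ c * total_mass Q" by simp
    also have "\<dots> \<le> 1/4 * total_mass Q"
    proof (rule mult_right_mono)
      show "exp 2 / (1 - \<rho>) / (21 / 20) ^ c \<le> 1 / 4" 
      proof -
        have "X / Y \<le> 1 / 4" if "4 * X < Y" "0 < Y" for X Y :: real
          using that by (simp add: field_simps)
        from this[OF c] show ?thesis by simp
      qed
    qed (use total_mass_pos[of Q] in auto)
    finally show "(\<Sum>S | S \<subseteq> Q \<and> irregular c Q S. recip_mass S) \<le> 1/4 * total_mass Q" .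
  qed
qed

section \<open>Few squarefree integers are obstructed\<close>

text \<open>
  If \<open>m\<close> divides \<open>2 g\<close>, then \<open>odd_half m\<close> divides \<open>g\<close>.
\<close>
definition odd_half :: "nat \<Rightarrow> nat" where
  "odd_half m = (if even m then m div 2 else m)"

text \<open>
  The divisors that an unfavourable pair forces on an integer, with \<open>128\<close> as the bound
  on the ratio of the two members of the pair.
\<close>
definition obstructed :: "nat \<Rightarrow> bool" where
  "obstructed k \<longleftrightarrow> (\<exists>x y. 1 < x \<and> 0 < y \<and> y < 128 * x \<and> big_omega y \<le> big_omega x \<and>
     x * odd_half (x + y) dvd k)"

lemma odd_half_bounds: "odd_half m \<le> m" "m \<le> 2 * odd_half m"
  by (auto simp: odd_half_def)

lemma card_prime_factors_odd_half: "0 < m \<Longrightarrow> card (prime_factors m) \<le> Suc (card (prime_factors (odd_half m)))"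
proof (cases "even m")
  case True
  assume "0 < m"
  then have m: "m = 2 * odd_half m" "0 < odd_half m" using True by (auto simp: odd_half_def)
  have "prime_factors m = prime_factors (2 * odd_half m)" using m(1) by simp
  also have "\<dots> = insert 2 (prime_factors (odd_half m))"
    using m(2) by (simp add: prime_factors_product prime_factorization_prime)
  finally show ?thesis by (simp add: card_insert_if)
qed (simp add: odd_half_def)

lemma card_prime_factors_le_big_omega: "card (prime_factors n) \<le> big_omega n"
  unfolding big_omega_def by (metis mset_set_set_mset_msubset size_mset_mono size_mset_set)

text \<open>
  Divisors of a product of distinct primes correspond to subsets of these primes.
\<close>
lemma dvd_prod_primes:
  fixes S :: "nat set"
  assumes S: "finite S" "\<And>p. p \<in> S \<Longrightarrow> prime p" and n: "n dvd \<Prod>S"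
  shows "prime_factorization n = mset_set (prime_factors n)" "prime_factors n \<subseteq> S" 
    "\<Prod>(prime_factors n) = n" "big_omega n = card (prime_factors n)"
proof -
  have pos: "0 < \<Prod>S" using S by (intro prod_pos) (auto intro!: prime_gt_0_nat)
  have "\<Prod>S = prod_mset (mset_set S)" by (simp add: prod_unfold_prod_mset)
  then have "prime_factorization (\<Prod>S) = mset_set S"
    using prime_factorization_prod_mset_primes[of "mset_set S"] S by simp
  moreover have "n \<noteq> 0" using n pos by auto
  ultimately have sub: "prime_factorization n \<subseteq># mset_set S"
    using n pos prime_factorization_subset_iff_dvd[of n "\<Prod>S"] by simp
  show "prime_factors n \<subseteq> S" using set_mset_mono[OF sub] S by simp
  show eq: "prime_factorization n = mset_set (prime_factors n)"
  proof (rule multiset_eqI)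
    fix p
    have "count (prime_factorization n) p \<le> 1"
      using mset_subset_eq_count[OF sub, of p] by (cases "p \<in> S") (auto simp: S)
    moreover have "p \<in> prime_factors n \<longleftrightarrow> 0 < count (prime_factorization n) p" by simp
    ultimately show "count (prime_factorization n) p = count (mset_set (prime_factors n)) p"
      by (simp only: count_mset_set') (auto simp del: count_greater_zero_iff)
  qed
  have "\<Prod>(prime_factors n) = prod_mset (mset_set (prime_factors n))" by (simp add: prod_unfold_prod_mset)
  also have "\<dots> = prod_mset (prime_factorization n)" by (simp only: eq[symmetric])
  also have "\<dots> = n" using \<open>n \<noteq> 0\<close> by (simp add: prod_mset_prime_factorization_nat)
  finally show "\<Prod>(prime_factors n) = n" .
  have "big_omega n = size (mset_set (prime_factors n))" unfolding big_omega_def by (subst eq) simp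
  then show "big_omega n = card (prime_factors n)" by simp
qed

text \<open>
  The primes that \<open>k\<close> must contain in order to be obstructed by \<open>(x, y)\<close>.
\<close>
definition witness_primes :: "nat \<Rightarrow> nat \<Rightarrow> nat set" where
  "witness_primes x y = prime_factors (x * odd_half (x + y))"

text \<open>
  The weight of a witness splits over \<open>x\<close> and \<open>x + y\<close>, since these parts are coprime. One half of the factor
  \<open>4^(-\<omega>(x))\<close> is traded for \<open>2^(-\<omega>(y))\<close> through \<open>\<Omega>(y) \<le> \<Omega>(x) = \<omega>(x)\<close>. As \<open>y < 128 x\<close>,
  both \<open>x\<close> and \<open>x + y\<close> are of size \<open>2 ^ K\<close>; the constant is \<open>4 * 258 * 4\<close>, with one factor 4 for a prime 2 lost in \<open>odd_half\<close>.
\<close>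
lemma witness_properties:
  fixes S :: "nat set"
  assumes S: "finite S" "\<And>p. p \<in> S \<Longrightarrow> prime p"
    and xy: "1 < x" "0 < y" "y < 128 * x" "big_omega y \<le> big_omega x"
    and dvd: "x * odd_half (x + y) dvd \<Prod>S"
    and K: "x + y < 2 ^ K" "2 ^ K \<le> 2 * (x + y)"
  shows "witness_primes x y \<subseteq> S \<inter> {..2 ^ K}"
    "(1/4) ^ card (witness_primes x y) * recip_mass (witness_primes x y) \<le> 4128 / 4 ^ K * factor_weight x y"
    "prime_factors x \<noteq> {}" "prime_factors x \<subseteq> S \<inter> {..2 ^ K}" "2 ^ K \<le> 4 * \<Prod>S"
proof -
  let ?m = "x + y" let ?m' = "odd_half (x + y)" let ?D = "witness_primes x y"
  have m'0: "0 < ?m'" using xy odd_half_bounds(2)[of ?m] by linarith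
  have dx: "x dvd \<Prod>S" using dvd by (rule dvd_mult_left)
  have dm: "?m' dvd \<Prod>S" using dvd by (rule dvd_mult_right)
  note px = dvd_prod_primes[OF S dx] and pm = dvd_prod_primes[OF S dm] and pD = dvd_prod_primes[OF S dvd]
  have Deq: "?D = prime_factors x \<union> prime_factors ?m'"
    unfolding witness_primes_def using xy m'0 by (intro prime_factors_product) auto
  have le: "p \<le> 2 ^ K" if "p \<in> prime_factors n" "n \<le> x + y" "0 < n" for p n
  proof -
    have "p dvd n" using that by auto
    then have "p \<le> n" using that by (intro dvd_imp_le) auto
    then show ?thesis using that K by linarith
  qed
  show sx: "prime_factors x \<subseteq> S \<inter> {..2 ^ K}"
  proof
    fix p assume p: "p \<in> prime_factors x"
    then show "p \<in> S \<inter> {..2 ^ K}" using le[OF p] px(2) xy by auto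
  qed
  show "?D \<subseteq> S \<inter> {..2 ^ K}"
  proof
    fix p assume p: "p \<in> ?D"
    show "p \<in> S \<inter> {..2 ^ K}"
    proof (cases "p \<in> prime_factors x")
      case True then show ?thesis using sx by blast
    next
      case False
      then have p: "p \<in> prime_factors ?m'" using p Deq by blast
      then show ?thesis using le[OF p odd_half_bounds(1) m'0] pm(2) by auto
    qed
  qed
  show "prime_factors x \<noteq> {}"
  proof -
    obtain p where "prime p" "p dvd x" using prime_factor_nat[of x] xy(1) by auto
    then have "p \<in> prime_factors x" using xy by (intro prime_factorsI) auto
    then show ?thesis by blast
  qed
  have pos: "0 < \<Prod>S" using S by (intro prod_pos) (auto intro!: prime_gt_0_nat)
  have "?m' \<le> \<Prod>S" using dm pos by (rule dvd_imp_le)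
  then have "4 * ?m' \<le> 4 * \<Prod>S" by (rule mult_le_mono2)
  moreover have "2 * ?m \<le> 4 * ?m'" using odd_half_bounds(2)[of ?m] by simp
  ultimately show "2 ^ K \<le> 4 * \<Prod>S" using K(2) by (meson order_trans)
  have cardD: "card ?D = card (prime_factors x) + card (prime_factors ?m')"
  proof -
    have "big_omega (x * ?m') = big_omega x + big_omega ?m'"
      unfolding big_omega_def using xy m'0 by (subst prime_factorization_mult) auto
    then show ?thesis using px(4) pm(4) pD(4) unfolding witness_primes_def by simp
  qed
  have massD: "recip_mass ?D = 1 / (real x * real ?m')"
  proof -
    have "recip_mass ?D = 1 / real (\<Prod>?D)" unfolding recip_mass_def by (simp add: prod_dividef)
    then show ?thesis using pD(3) unfolding witness_primes_def by simp
  qed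
  let ?a = "card (prime_factors x)" let ?b = "card (prime_factors ?m)" 
  let ?b' = "card (prime_factors ?m')" let ?c = "card (prime_factors y)"
  have ca: "?c \<le> ?a" using card_prime_factors_le_big_omega[of y] xy(4) px(4) by linarith
  have bb: "?b \<le> Suc ?b'" using xy by (intro card_prime_factors_odd_half) auto
  have "(1/4 :: real) ^ ?a = (1/2) ^ ?a * (1/2) ^ ?a" by (simp flip: power_mult_distrib)
  also have "\<dots> \<le> (1/2) ^ ?a * (1/2) ^ ?c" using ca by (intro mult_left_mono power_decreasing) auto
  finally have w1: "(1/4 :: real) ^ ?a \<le> (1/2) ^ ?a * (1/2) ^ ?c" .
  have "(1/4 :: real) ^ Suc ?b' \<le> (1/4) ^ ?b" using bb by (intro power_decreasing) auto
  then have w2: "(1/4 :: real) ^ ?b' \<le> 4 * (1/4) ^ ?b" by simp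
  have w3: "1 / (real x * real ?m') \<le> 1032 / 4 ^ K"
  proof -
    have "2 * ?m \<le> 258 * x" using xy(3) by simp
    then have "real (2 ^ K) \<le> real (258 * x)" by (intro of_nat_mono order_trans[OF K(2)])
    moreover have "2 * ?m \<le> 4 * ?m'" using odd_half_bounds(2)[of ?m] by simp
    then have "real (2 ^ K) \<le> real (4 * ?m')" by (intro of_nat_mono order_trans[OF K(2)])
    ultimately have "real (2 ^ K) * real (2 ^ K) \<le> real (258 * x) * real (4 * ?m')" by (intro mult_mono) auto
    moreover have "real (2 ^ K) * real (2 ^ K) = 4 ^ K" by (simp flip: power_mult_distrib)
    ultimately have "4 ^ K \<le> 1032 * (real x * real ?m')" by simp
    moreover have "0 < real x * real ?m'" using xy m'0 by simp
    ultimately show ?thesis by (simp add: divide_simps)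
  qed
  have "(1/4) ^ card ?D * recip_mass ?D = (1/4) ^ ?a * (1/4) ^ ?b' * (1 / (real x * real ?m'))"
    by (simp only: cardD massD power_add)
  also have "\<dots> \<le> ((1/2) ^ ?a * (1/2) ^ ?c) * (4 * (1/4) ^ ?b) * (1032 / 4 ^ K)"
    using w1 w2 w3 by (intro mult_mono mult_nonneg_nonneg) auto
  also have "\<dots> = 4128 / 4 ^ K * factor_weight x y" by (simp add: factor_weight_def)
  finally show "(1/4) ^ card ?D * recip_mass ?D \<le> 4128 / 4 ^ K * factor_weight x y" .
qed

lemma exp_7_5: "4 \<le> exp (7/5 :: real)"
proof -
  have "(119/100 :: real) \<le> 1 + 7/40 + (7/40)\<^sup>2 / 2" by (simp add: power2_eq_square)
  also have "\<dots> \<le> exp (7/40)" by (rule exp_lower_Taylor_quadratic) simp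
  finally have "(119/100 :: real) ^ 8 \<le> exp (7/40) ^ 8" by (intro power_mono) auto
  also have "\<dots> = exp (7/5)" by (simp flip: exp_of_nat_mult)
  finally show ?thesis by (simp add: power_numeral_reduce)
qed

lemma factor_weight_nonneg: "0 \<le> factor_weight x y"
  by (simp add: factor_weight_def)

lemma sum_Sigma_Times:
  fixes f :: "'a \<Rightarrow> 'b \<Rightarrow> 'c \<Rightarrow> real"
  assumes "finite A" "\<And>K. finite (X K)" "\<And>K. finite (Y K)"
  shows "(\<Sum>(K, x, y)\<in>(SIGMA K:A. X K \<times> Y K). f K x y) = (\<Sum>K\<in>A. \<Sum>x\<in>X K. \<Sum>y\<in>Y K. f K x y)"
  using sum.Sigma[of A "\<lambda>K. X K \<times> Y K" "\<lambda>K (x, y). f K x y"] assms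
  by (simp add: sum.cartesian_product)

text \<open>
  Union bound over the scale \<open>K\<close> of \<open>x + y\<close> and over the pairs \<open>(x, y)\<close> of this scale. The exponent
  \<open>18/25 = 7/5 * 21/20 - 3/4\<close> uses \<open>ln 4 \<le> 7/5\<close>.
\<close>
lemma obstructed_mass_explicit:
  fixes Q :: "nat set"
  assumes Q: "finite Q" "\<And>p. p \<in> Q \<Longrightarrow> prime p" "\<And>p. p \<in> Q \<Longrightarrow> 2 ^ K0 < p"
  shows "(\<Sum>S | S \<subseteq> Q \<and> obstructed (\<Prod>S) \<and> \<not> irregular c Q S. recip_mass S) \<le>
    (\<Sum>K=K0..<4 * \<Prod>Q. (\<Sum>x\<in>{1..<2^K}. \<Sum>y\<in>{1..<2^K}. factor_weight x y) / 4 ^ K * 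
       exp (7/5 * real c + 9 + 18/25 * recip_primes K)) * (4128 * total_mass Q)"
proof -
  let ?R = "\<lambda>K::nat. Q \<inter> {..2 ^ K}"
  let ?b = "\<lambda>K. 21/20 * (recip_sum (?R K) + 1) + real c"
  let ?P = "\<lambda>K x y. witness_primes x y \<subseteq> ?R K \<and> 
     (1/4) ^ card (witness_primes x y) * recip_mass (witness_primes x y) \<le> 4128 / 4 ^ K * factor_weight x y"
  let ?E = "\<lambda>(K, x, y). {S. ?P K x y \<and> S \<subseteq> Q \<and> witness_primes x y \<subseteq> S \<and> real (card (S \<inter> ?R K)) \<le> ?b K}"
  let ?I = "SIGMA K:{K0..<4 * \<Prod>Q}. {1..<(2::nat)^K} \<times> {1..<(2::nat)^K}"
  have finE: "finite (?E i)" for i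
    by (rule finite_subset[of _ "Pow Q"]) (use Q(1) in \<open>auto split: prod.splits\<close>)
  have "{S. S \<subseteq> Q \<and> obstructed (\<Prod>S) \<and> \<not> irregular c Q S} \<subseteq> (\<Union>i\<in>?I. ?E i)"
  proof
    fix S assume "S \<in> {S. S \<subseteq> Q \<and> obstructed (\<Prod>S) \<and> \<not> irregular c Q S}"
    then have S: "S \<subseteq> Q" and reg: "\<not> irregular c Q S" and "obstructed (\<Prod>S)" by auto
    then obtain x y where xy: "1 < x" "0 < y" "y < 128 * x" "big_omega y \<le> big_omega x"
      "x * odd_half (x + y) dvd \<Prod>S" by (auto simp: obstructed_def)
    have finS: "finite S" by (rule finite_subset[OF S Q(1)])
    have prS: "\<And>p. p \<in> S \<Longrightarrow> prime p" using S Q(2) by blast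
    obtain k where k: "2 ^ k \<le> x + y" "x + y < 2 ^ (k + 1)"
      using ex_power_ivl1[of 2 "x + y"] xy by auto
    \<comment> \<open>Since \<open>x + y < 2 ^ K\<close>, all witness primes are at most \<open>2 ^ K\<close>, and \<open>2 ^ K0 < p \<le> 2 ^ K\<close> for a prime factor \<open>p\<close> of \<open>x\<close>.\<close>
    define K where "K = Suc k"
    have K: "x + y < 2 ^ K" "2 ^ K \<le> 2 * (x + y)" using k by (auto simp: K_def)
    note w = witness_properties[OF finS prS xy K]
    obtain p where p: "p \<in> prime_factors x" using w(3) by blast
    then have "2 ^ K0 < p" "p \<le> 2 ^ K" using w(4) S Q(3) by auto
    then have "(2::nat) ^ K0 < 2 ^ K" by linarith
    then have "K0 \<le> K" by simp
    moreover have "K < 4 * \<Prod>Q"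
    proof -
      have "K < 2 ^ K" by simp
      also have "\<dots> \<le> 4 * \<Prod>S" by (rule w(5))
      also have "\<Prod>S \<le> \<Prod>Q"
      proof (rule dvd_imp_le)
        show "\<Prod>S dvd \<Prod>Q" by (rule prod_dvd_prod_subset[OF Q(1) S])
        show "0 < \<Prod>Q" using Q(2) by (intro prod_pos) (auto intro!: prime_gt_0_nat)
      qed
      finally show ?thesis by simp
    qed
    moreover have "x < 2 ^ K" "y < 2 ^ K" using K by auto
    ultimately have "(K, x, y) \<in> ?I" using xy by auto
    moreover have "S \<in> ?E (K, x, y)"
    proof -
      have "real (card (S \<inter> ?R K)) \<le> ?b K" using reg unfolding irregular_def not_ex not_less by blast
      then show ?thesis using w(1,2) S by auto
    qed
    ultimately show "S \<in> (\<Union>i\<in>?I. ?E i)" by blast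
  qed
  then have "(\<Sum>S | S \<subseteq> Q \<and> obstructed (\<Prod>S) \<and> \<not> irregular c Q S. recip_mass S) \<le> (\<Sum>i\<in>?I. \<Sum>S\<in>?E i. recip_mass S)"
    by (intro sum_le_sum_cover finE recip_mass_nonneg) auto
  also have "\<dots> \<le> (\<Sum>(K, x, y)\<in>?I. factor_weight x y / 4 ^ K * exp (7/5 * real c + 9 + 18/25 * recip_primes K) * (4128 * total_mass Q))"
  proof (rule sum_mono)
    fix i assume "i \<in> ?I"
    obtain K x y where i: "i = (K, x, y)" by (metis prod_cases3)
    let ?g = "exp (7/5 * real c + 9 + 18/25 * recip_primes K)"
    have rhs0: "0 \<le> factor_weight x y / 4 ^ K * ?g * (4128 * total_mass Q)"
      using factor_weight_nonneg[of x y] total_mass_pos[of Q] by simp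
    have "(\<Sum>S\<in>?E (K, x, y). recip_mass S) \<le> factor_weight x y / 4 ^ K * ?g * (4128 * total_mass Q)"
    proof (cases "?P K x y")
      case False
      then have "?E (K, x, y) = {}" by (simp only: prod.case) blast
      then show ?thesis using rhs0 by (simp only: sum.empty)
    next
      case True
      then have "(\<Sum>S\<in>?E (K, x, y). recip_mass S) = 
         (\<Sum>S | S \<subseteq> Q \<and> witness_primes x y \<subseteq> S \<and> real (card (S \<inter> ?R K)) \<le> ?b K. recip_mass S)"
        by (intro sum.cong) auto
      also have "\<dots> \<le> 4 powr (?b K) * ((1/4) ^ card (witness_primes x y) * recip_mass (witness_primes x y)) * 
          (exp (2 - 3/4 * recip_sum (?R K)) * total_mass Q)"
        unfolding recip_sum_def using True by (intro mass_supersets_few_primes_le Q) auto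
      also have "\<dots> \<le> exp (7/5 * ?b K) * (4128 / 4 ^ K * factor_weight x y) * 
          (exp (2 - 3/4 * recip_sum (?R K)) * total_mass Q)"
      proof (rule mult_right_mono[OF mult_mono])
        have b0: "0 \<le> ?b K" by (simp add: recip_sum_def sum_nonneg)
        have "4 powr (?b K) \<le> exp (7/5) powr (?b K)" using b0 exp_7_5 by (intro powr_mono2) auto
        also have "\<dots> = exp (7/5 * ?b K)" by (simp add: powr_def mult.commute)
        finally show "4 powr (?b K) \<le> exp (7/5 * ?b K)" .
        show "0 \<le> (1/4) ^ card (witness_primes x y) * recip_mass (witness_primes x y)"
          by (intro mult_nonneg_nonneg recip_mass_nonneg) simp
      qed (use True total_mass_pos[of Q] in auto)
      also have "\<dots> = factor_weight x y / 4 ^ K * (exp (7/5 * ?b K) * exp (2 - 3/4 * recip_sum (?R K))) * (4128 * total_mass Q)"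
        by simp
      also have "\<dots> \<le> factor_weight x y / 4 ^ K * ?g * (4128 * total_mass Q)"
      proof (rule mult_right_mono[OF mult_left_mono])
        have "recip_sum (?R K) \<le> recip_primes K"
          unfolding recip_sum_def recip_primes_def using Q(2) by (intro sum_mono2) auto
        then have "7/5 * ?b K + (2 - 3/4 * recip_sum (?R K)) \<le> 7/5 * real c + 9 + 18/25 * recip_primes K"
          by (simp add: algebra_simps)
        then show "exp (7/5 * ?b K) * exp (2 - 3/4 * recip_sum (?R K)) \<le> ?g"
          unfolding exp_add[symmetric] by simp
      qed (use total_mass_pos[of Q] factor_weight_nonneg[of x y] in auto)
      finally show ?thesis .
    qed
    then show "(\<Sum>S\<in>?E i. recip_mass S) \<le> (case i of (K, x, y) \<Rightarrow>
       factor_weight x y / 4 ^ K * exp (7/5 * real c + 9 + 18/25 * recip_primes K) * (4128 * total_mass Q))"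
      unfolding i by simp
  qed
  also have "\<dots> = (\<Sum>K=K0..<4 * \<Prod>Q. \<Sum>x\<in>{1..<2^K}. \<Sum>y\<in>{1..<2^K}. 
      factor_weight x y / 4 ^ K * exp (7/5 * real c + 9 + 18/25 * recip_primes K) * (4128 * total_mass Q))"
    by (rule sum_Sigma_Times) auto
  also have "\<dots> = (\<Sum>K=K0..<4 * \<Prod>Q. (\<Sum>x\<in>{1..<2^K}. \<Sum>y\<in>{1..<2^K}. factor_weight x y) / 4 ^ K * 
       exp (7/5 * real c + 9 + 18/25 * recip_primes K)) * (4128 * total_mass Q)"
    by (simp only: sum_distrib_right sum_divide_distrib)
  finally show ?thesis .
qed

text \<open>
  The scale \<open>K\<close> contributes \<open>K^(1/100) exp ((18/25 - 7/4) M(K))\<close> with \<open>18/25 - 7/4 = -103/100\<close>, and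
  \<open>exp (M(K)) \<ge> K / 4\<close>. So the contributions are summable, and discarding the primes up to \<open>Z\<close> leaves only a tail.
\<close>
proposition obstructed_mass:
  obtains Z where "\<And>Q. finite Q \<Longrightarrow> (\<And>p. p \<in> Q \<Longrightarrow> prime p) \<Longrightarrow> (\<And>p. p \<in> Q \<Longrightarrow> Z < p) \<Longrightarrow>
    (\<Sum>S | S \<subseteq> Q \<and> obstructed (\<Prod>S). recip_mass S) \<le> 1/2 * total_mass Q"
proof -
  obtain c where c: "\<And>Q. finite Q \<Longrightarrow> (\<And>p. p \<in> Q \<Longrightarrow> prime p) \<Longrightarrow> 
    (\<Sum>S | S \<subseteq> Q \<and> irregular c Q S. recip_mass S) \<le> 1/4 * total_mass Q"
    using irregular_mass by blast
  obtain C where C: "0 < C" "\<forall>\<^sub>F K in sequentially. 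
     (\<Sum>x\<in>{1..<2^K}. \<Sum>y\<in>{1..<2^K}. factor_weight x y) \<le>
       C * 4 ^ K * (real K powr (1/100) * exp (- (7/4) * recip_primes K))"
    using sum_factor_weight_asymptotic by blast
  define B where "B = C * exp (7/5 * real c + 9) * 4 powr (103/100)"
  have B0: "0 < B" using C by (simp add: B_def)
  let ?F = "\<lambda>K. (\<Sum>x\<in>{1..<2^K}. \<Sum>y\<in>{1..<2^K}. factor_weight x y) / 4 ^ K * 
       exp (7/5 * real c + 9 + 18/25 * recip_primes K)"
  have "\<forall>\<^sub>F K in sequentially. ?F K \<le> B * real K powr (- 102/100)"
    using C(2) eventually_gt_at_top[of 0]
  proof eventually_elim
    case (elim K)
    let ?e = "exp (7/5 * real c + 9 + 18/25 * recip_primes K)"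
    have "?F K \<le> C * (real K powr (1/100) * exp (- (7/4) * recip_primes K)) * ?e"
      using elim(1) by (intro mult_right_mono) (auto simp: divide_simps mult_ac)
    also have "\<dots> = C * exp (7/5 * real c + 9) * (real K powr (1/100) * exp (- (103/100) * recip_primes K))"
      by (simp add: exp_add[symmetric] mult_ac)
    also have "exp (- (103/100) * recip_primes K) \<le> (real K / 4) powr (- 103/100)"
    proof -
      have "exp (recip_primes K) powr (- 103/100) \<le> (real K / 4) powr (- 103/100)"
        using elim(2) exp_recip_primes_lower[of K] by (intro powr_mono2') auto
      then show ?thesis by (simp add: powr_def mult.commute)
    qed
    also have "(real K / 4) powr (- 103/100) = 4 powr (103/100) * real K powr (- 103/100)"
      using elim(2) by (simp add: powr_divide powr_minus divide_simps)
    also have "C * exp (7/5 * real c + 9) * (real K powr (1/100) * (4 powr (103/100) * real K powr (- 103/100)))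
       = B * (real K powr (1/100) * real K powr (- 103/100))" by (simp add: B_def)
    also have "real K powr (1/100) * real K powr (- 103/100) = real K powr (- 102/100)"
      by (simp add: powr_add[symmetric])
    finally show ?case using C by (simp add: mult_left_mono)
  qed
  then obtain K1 where K1: "\<And>K. K1 \<le> K \<Longrightarrow> ?F K \<le> B * real K powr (- 102/100)"
    by (auto simp: eventually_sequentially)
  have "summable (\<lambda>K. real K powr (- 102/100))" using summable_real_powr_iff[of "- 102/100"] by simp
  moreover have "0 < 1 / (4 * 4128 * B)" using B0 by simp
  ultimately obtain K2 where K2: "\<And>m n. K2 \<le> m \<Longrightarrow> norm (\<Sum>K=m..<n. real K powr (- 102/100)) < 1 / (4 * 4128 * B)"
    unfolding summable_Cauchy by blast
  define K0 where "K0 = max K1 K2"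
  show thesis
  proof (rule that[of "2 ^ K0"])
    fix Q :: "nat set"
    assume Q: "finite Q" "\<And>p. p \<in> Q \<Longrightarrow> prime p" "\<And>p. p \<in> Q \<Longrightarrow> 2 ^ K0 < p"
    have M: "0 < total_mass Q" by (rule total_mass_pos)
    have "(\<Sum>S | S \<subseteq> Q \<and> obstructed (\<Prod>S) \<and> \<not> irregular c Q S. recip_mass S) \<le>
        (\<Sum>K=K0..<4 * \<Prod>Q. ?F K) * (4128 * total_mass Q)"
      by (rule obstructed_mass_explicit[OF Q])
    also have "\<dots> \<le> (\<Sum>K=K0..<4 * \<Prod>Q. B * real K powr (- 102/100)) * (4128 * total_mass Q)"
      using M by (intro mult_right_mono sum_mono K1) (auto simp: K0_def)
    also have "\<dots> = B * (\<Sum>K=K0..<4 * \<Prod>Q. real K powr (- 102/100)) * (4128 * total_mass Q)"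
      by (simp only: sum_distrib_left)
    also have "\<dots> \<le> B * (1 / (4 * 4128 * B)) * (4128 * total_mass Q)"
      using K2[of K0 "4 * \<Prod>Q"] M B0 by (intro mult_right_mono mult_left_mono) (auto simp: K0_def)
    also have "\<dots> = 1/4 * total_mass Q" using B0 by simp
    finally have reg: "(\<Sum>S | S \<subseteq> Q \<and> obstructed (\<Prod>S) \<and> \<not> irregular c Q S. recip_mass S) \<le> 1/4 * total_mass Q" .
    have fin: "finite {S. S \<subseteq> Q \<and> P S}" for P
      by (rule finite_subset[of _ "Pow Q"]) (use Q(1) in auto)
    have "(\<Sum>S | S \<subseteq> Q \<and> obstructed (\<Prod>S). recip_mass S) \<le> 
       (\<Sum>S \<in> {S. S \<subseteq> Q \<and> (obstructed (\<Prod>S) \<and> \<not> irregular c Q S)} \<union> {S. S \<subseteq> Q \<and> irregular c Q S}. recip_mass S)"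
      by (intro sum_mono2 recip_mass_nonneg finite_UnI fin) auto
    also have "\<dots> = (\<Sum>S | S \<subseteq> Q \<and> (obstructed (\<Prod>S) \<and> \<not> irregular c Q S). recip_mass S) + (\<Sum>S | S \<subseteq> Q \<and> irregular c Q S. recip_mass S)"
      by (intro sum.union_disjoint fin) auto
    also have "\<dots> \<le> 1/4 * total_mass Q + 1/4 * total_mass Q" by (intro add_mono reg c Q)
    finally show "(\<Sum>S | S \<subseteq> Q \<and> obstructed (\<Prod>S). recip_mass S) \<le> 1/2 * total_mass Q" by simp
  qed
qed

section \<open>From unobstructed integers to the density of A_N\<close>

lemma big_omega_mult: "0 < a \<Longrightarrow> 0 < b \<Longrightarrow> big_omega (a * b) = big_omega a + big_omega b"
  by (simp add: big_omega_def prime_factorization_mult)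

lemma big_omega_eq_0: "0 < n \<Longrightarrow> big_omega n = 0 \<Longrightarrow> n = 1"
  by (simp add: big_omega_def prime_factorization_empty_iff)

text \<open>
  If \<open>p\<close> divided \<open>x\<close>, then \<open>odd_half (x + y)\<close> would divide \<open>k\<close> and \<open>p \<le> x < x + y \<le> 2 k\<close>; if \<open>p\<close> divided
  \<open>odd_half (x + y)\<close>, then \<open>x\<close> would divide \<open>k\<close> and \<open>p \<le> x + y < 129 k\<close>. Both contradict \<open>p > 258 k\<close>,
  hence the obstruction divides \<open>k\<close>.
\<close>
lemma mult_unobstructed_in_A_set:
  assumes k: "0 < k" "\<not> obstructed k" and p: "prime p" "258 * k < p"
    and N: "p * k \<le> N" "N < 128 * (p * k)"
  shows "p * k \<in> A_set N"
proof -
  define a where "a = p * k"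
  have a0: "0 < a" using k p prime_gt_0_nat by (simp add: a_def)
  have "\<not> (a + b) dvd (2 * a * b)" if b: "b \<in> {1..N}" "a \<noteq> b" "big_omega b \<le> big_omega a" for b
  proof
    assume div: "(a + b) dvd (2 * a * b)"
    have b0: "0 < b" using b by simp
    define g where "g = gcd a b"
    have g0: "0 < g" using a0 by (simp add: g_def)
    obtain x y where xy: "a = g * x" "b = g * y" "coprime x y"
      using gcd_coprime_exists[of a b] g0 unfolding g_def by (metis mult.commute not_gr_zero)
    have x0: "0 < x" and y0: "0 < y" using a0 b0 xy by (auto intro: Nat.gr0I)
    have "g * (x + y) dvd g * (2 * g * (x * y))" using div by (simp add: xy algebra_simps)
    then have "(x + y) dvd (2 * g) * (x * y)" using g0 by (simp only: nat_mult_dvd_cancel1)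
    moreover have "coprime (x + y) (x * y)"
    proof -
      have "coprime (x + y) x" using xy(3) by (metis add.commute coprime_commute gcd_add1 coprime_iff_gcd_eq_1)
      moreover have "coprime (x + y) y" using xy(3) by (metis gcd_add1 coprime_iff_gcd_eq_1)
      ultimately show ?thesis by simp
    qed
    ultimately have m: "(x + y) dvd 2 * g" using coprime_dvd_mult_left_iff by blast
    have om: "big_omega y \<le> big_omega x"
      using b(3) unfolding xy using big_omega_mult[OF g0 x0] big_omega_mult[OF g0 y0] by simp
    have "x \<noteq> 1"
    proof
      assume "x = 1"
      then have "big_omega y = 0" using om by (simp add: big_omega_def)
      then have "y = 1" using y0 big_omega_eq_0 by blast
      then show False using \<open>x = 1\<close> xy b(2) by simp
    qed
    then have x1: "1 < x" using x0 by simp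
    have y128: "y < 128 * x"
    proof -
      have "b < 128 * a" using b(1) N(2) unfolding a_def[symmetric] by simp
      also have "128 * a = g * (128 * x)" by (simp add: xy(1))
      finally have "g * y < g * (128 * x)" by (simp only: xy(2))
      then show ?thesis by simp
    qed
    have half: "odd_half (x + y) dvd g"
    proof (cases "even (x + y)")
      case True
      then have "2 * odd_half (x + y) dvd 2 * g" using m by (simp add: odd_half_def)
      then show ?thesis by simp
    next
      case False
      then have "coprime (x + y) 2" by (simp add: coprime_commute)
      then show ?thesis using m False by (simp add: odd_half_def coprime_dvd_mult_right_iff)
    qed
    let ?m' = "odd_half (x + y)"
    have dvd: "x * ?m' dvd p * k"
    proof -
      have "x * ?m' dvd x * g" using half by simp
      then show ?thesis using xy(1) unfolding a_def by (simp add: mult.commute)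
    qed
    have m'0: "0 < ?m'" using odd_half_bounds(2)[of "x + y"] x0 by simp
    have p0: "0 < p" using p(1) prime_gt_0_nat by blast
    have nx: "\<not> p dvd x"
    proof
      assume "p dvd x"
      then obtain x' where x': "x = p * x'" ..
      have "p * (x' * ?m') dvd p * k" using dvd x' by (simp add: mult.assoc)
      then have "x' * ?m' dvd k" using p0 by (simp only: nat_mult_dvd_cancel1)
      then have "?m' dvd k" by (rule dvd_mult_right)
      then have "?m' \<le> k" using k by (intro dvd_imp_le)
      moreover have "p \<le> x" using \<open>p dvd x\<close> x0 by (rule dvd_imp_le)
      ultimately show False using odd_half_bounds(2)[of "x + y"] p(2) by simp
    qed
    have nm: "\<not> p dvd ?m'"
    proof
      assume "p dvd ?m'"
      then obtain m1 where m1: "?m' = p * m1" ..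
      have "p * (x * m1) dvd p * k" using dvd m1 by (simp add: mult_ac)
      then have "x * m1 dvd k" using p0 by (simp only: nat_mult_dvd_cancel1)
      then have "x dvd k" by (rule dvd_mult_left)
      then have "x \<le> k" using k by (intro dvd_imp_le)
      moreover have "p \<le> ?m'" using \<open>p dvd ?m'\<close> m'0 by (rule dvd_imp_le)
      ultimately show False using odd_half_bounds(1)[of "x + y"] p(2) y128 by simp
    qed
    have "coprime p (x * ?m')" using nx nm p(1) by (simp add: prime_imp_coprime)
    then have "x * ?m' dvd k" using dvd by (simp add: coprime_commute coprime_dvd_mult_right_iff)
    then have "obstructed k" unfolding obstructed_def using x1 y0 y128 om by blast
    then show False using k by simp
  qed
  then show ?thesis using a0 N(1) unfolding A_set_def a_def[symmetric] by auto
qed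

text \<open>
  Markov's inequality for \<open>log k\<close>, whose mean is at most the sum of \<open>ln p / p\<close>.
\<close>
lemma mass_large_products_le:
  fixes Q :: "nat set"
  assumes Q: "finite Q" "\<And>p. p \<in> Q \<Longrightarrow> prime p" and m: "0 < m"
  shows "(\<Sum>S | S \<subseteq> Q \<and> 2 ^ m < \<Prod>S. recip_mass S) \<le> 
    (\<Sum>p\<in>Q. ln (real p) / real p) / (real m * ln 2) * total_mass Q"
proof -
  let ?L = "real m * ln 2"
  have L: "0 < ?L" using m by simp
  have ln0: "0 \<le> ln (real p)" if "p \<in> Q" for p using Q(2)[OF that] prime_ge_1_nat[of p] by simp
  have "(\<Sum>S | S \<subseteq> Q \<and> 2 ^ m < \<Prod>S. recip_mass S) \<le> 
        (\<Sum>S | S \<subseteq> Q \<and> 2 ^ m < \<Prod>S. \<Sum>p\<in>S. ln (real p) / ?L * recip_mass S)"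
  proof (rule sum_mono)
    fix S assume S: "S \<in> {S. S \<subseteq> Q \<and> 2 ^ m < \<Prod>S}"
    have pos: "0 < real p" if "p \<in> S" for p using S Q(2)[of p] that prime_gt_0_nat[of p] by auto
    have "real (2 ^ m) < real (\<Prod>S)" using S by (intro of_nat_less_iff[THEN iffD2]) auto
    then have "2 ^ m \<le> (\<Prod>p\<in>S. real p)" by simp
    then have "ln (2 ^ m) \<le> ln (\<Prod>p\<in>S. real p)" using pos by (subst ln_le_cancel_iff) (auto intro!: prod_pos)
    also have "\<dots> = (\<Sum>p\<in>S. ln (real p))"
      using pos finite_subset[of S Q] S Q(1) by (intro ln_prod) auto
    finally have "?L \<le> (\<Sum>p\<in>S. ln (real p))" by (simp add: ln_realpow)
    then have "1 \<le> (\<Sum>p\<in>S. ln (real p)) / ?L" using L by simp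
    then have "1 * recip_mass S \<le> (\<Sum>p\<in>S. ln (real p)) / ?L * recip_mass S"
      by (intro mult_right_mono recip_mass_nonneg)
    then show "recip_mass S \<le> (\<Sum>p\<in>S. ln (real p) / ?L * recip_mass S)"
      by (simp only: sum_distrib_right sum_divide_distrib mult_1)
  qed
  also have "\<dots> \<le> (\<Sum>S\<in>Pow Q. \<Sum>p\<in>S. ln (real p) / ?L * recip_mass S)"
  proof (rule sum_mono2)
    fix S assume "S \<in> Pow Q - {S. S \<subseteq> Q \<and> 2 ^ m < \<Prod>S}"
    then show "0 \<le> (\<Sum>p\<in>S. ln (real p) / ?L * recip_mass S)"
      using ln0 L by (intro sum_nonneg mult_nonneg_nonneg divide_nonneg_nonneg recip_mass_nonneg) auto
  qed (use Q(1) in auto)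
  also have "\<dots> = (\<Sum>S\<in>Pow Q. \<Sum>p | p \<in> Q \<and> p \<in> S. ln (real p) / ?L * recip_mass S)"
    by (intro sum.cong refl) auto
  also have "\<dots> = (\<Sum>p\<in>Q. \<Sum>S | S \<in> Pow Q \<and> p \<in> S. ln (real p) / ?L * recip_mass S)"
    using Q(1) by (intro sum.swap_restrict) auto
  also have "\<dots> = (\<Sum>p\<in>Q. ln (real p) / ?L * (\<Sum>S | S \<subseteq> Q \<and> {p} \<subseteq> S. recip_mass S))"
    by (simp add: sum_distrib_left)
  also have "\<dots> \<le> (\<Sum>p\<in>Q. ln (real p) / ?L * (1 / real p * total_mass Q))"
  proof (intro sum_mono mult_left_mono)
    fix p assume p: "p \<in> Q"
    have "(\<Sum>S | S \<subseteq> Q \<and> {p} \<subseteq> S. recip_mass S) = 1 / real p * (\<Prod>p\<in>Q - {p}. 1 + 1 / real p)"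
      unfolding recip_mass_def using Q(1) p by (subst sum_supersets_prod) auto
    also have "\<dots> \<le> 1 / real p * total_mass Q"
      unfolding total_mass_def using Q(1) by (intro mult_left_mono prod_mono2) auto
    finally show "(\<Sum>S | S \<subseteq> Q \<and> {p} \<subseteq> S. recip_mass S) \<le> 1 / real p * total_mass Q" .
    show "0 \<le> ln (real p) / ?L" using ln0[OF p] L by (intro divide_nonneg_nonneg) auto
  qed
  also have "\<dots> = (\<Sum>p\<in>Q. ln (real p) / real p) / ?L * total_mass Q"
    unfolding sum_divide_distrib sum_distrib_right by (intro sum.cong refl) simp
  finally show ?thesis .
qed

text \<open>
  The primes between \<open>N / (128 k)\<close> and \<open>N / k\<close>, up to rounding to powers of 2; since \<open>k\<close> is at most about
  \<open>N^(1/4)\<close>, these are far larger than \<open>k\<close> and than the prime factors of \<open>k\<close>.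
\<close>
lemma prime_slots:
  assumes n: "80 \<le> n" "2 ^ n \<le> N" "N < 2 ^ Suc n" and k: "0 < k" "k \<le> 2 ^ (n div 4)"
  shows "\<exists>P. finite P \<and> (\<forall>p\<in>P. prime p \<and> 258 * k < p \<and> p * k \<le> N \<and> N < 128 * (p * k) \<and> 2 ^ (n div 80) < p) \<and>
      real N / (8 * real n) * (1 / real k) \<le> real (card P)"
proof -
  have "k \<le> N"
  proof -
    have "(2::nat) ^ (n div 4) \<le> 2 ^ n" by (intro power_increasing) auto
    then show ?thesis using k n by (meson order_trans)
  qed
  then have "1 \<le> N div k" using k by (simp add: Suc_le_eq div_greater_zero_iff)
  then obtain j where j: "2 ^ j \<le> N div k" "N div k < 2 ^ (j + 1)"
    using ex_power_ivl1[of 2 "N div k"] by auto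
  have "N < (N div k + 1) * k" using dividend_less_div_times[OF k(1), of N] by simp
  also have "\<dots> \<le> 2 ^ (j + 1) * k" using j(2) by (intro mult_right_mono) auto
  finally have Nk: "N < 2 ^ (j + 1) * k" .
  have jlow: "n < j + 1 + n div 4"
  proof -
    have "2 ^ n \<le> N" by (rule n(2))
    also have "N < 2 ^ (j + 1) * k" by (rule Nk)
    also have "\<dots> \<le> 2 ^ (j + 1) * 2 ^ (n div 4)" using k(2) by (rule mult_le_mono2)
    also have "\<dots> = 2 ^ (j + 1 + n div 4)" by (simp only: power_add)
    finally show ?thesis by (rule power_less_imp_less_exp[rotated]) simp
  qed
  have jn: "j \<le> n"
  proof -
    have "2 ^ j \<le> N div k" by (rule j(1))
    also have "\<dots> \<le> N" by simp
    also have "\<dots> < 2 ^ Suc n" by (rule n(3))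
    finally have "j < Suc n" by (rule power_less_imp_less_exp[rotated]) simp
    then show ?thesis by simp
  qed
  define P where "P = primes_upto (2 ^ j) - primes_upto (2 ^ (j - 6))"
  have P: "prime p" "2 ^ (j - 6) < p" "p \<le> 2 ^ j" if "p \<in> P" for p using that by (auto simp: P_def)
  show ?thesis
  proof (intro exI[of _ P] conjI ballI)
    show "finite P" by (simp add: P_def)
    fix p assume p: "p \<in> P"
    show "prime p" by (rule P[OF p])
    have "9 + n div 4 \<le> j - 6" using jlow n(1) by linarith
    then have "(2::nat) ^ (9 + n div 4) \<le> 2 ^ (j - 6)" by (intro power_increasing) auto
    then have "512 * 2 ^ (n div 4) < p" using P(2)[OF p] by (simp add: power_add)
    then show "258 * k < p" using k by linarith
    have "p * k \<le> (N div k) * k" using P(3)[OF p] j(1) by (intro mult_right_mono) (auto intro: order_trans)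
    also have "\<dots> \<le> N" by simp
    finally show "p * k \<le> N" .
    have "(2::nat) ^ (j + 1) = 2 ^ (j - 6) * 128"
    proof -
      have "j + 1 = (j - 6) + 7" using jlow n(1) by linarith
      then have "(2::nat) ^ (j + 1) = 2 ^ ((j - 6) + 7)" by (simp only:)
      then show ?thesis by (simp add: power_add)
    qed
    then have "N < 128 * (2 ^ (j - 6) * k)" using Nk by (simp add: mult_ac)
    also have "\<dots> \<le> 128 * (p * k)" using P(2)[OF p] by (intro mult_left_mono mult_right_mono) auto
    finally show "N < 128 * (p * k)" .
    have "n div 80 \<le> j - 6" using jlow n(1) by linarith
    then have "(2::nat) ^ (n div 80) \<le> 2 ^ (j - 6)" by (intro power_increasing) auto
    then show "2 ^ (n div 80) < p" using P(2)[OF p] by linarith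
  next
    have "12 \<le> j" using jlow n(1) by linarith
    then have "2 ^ j \<le> 4 * j * card P" unfolding P_def by (rule card_primes_between)
    also have "\<dots> \<le> 4 * n * card P" using jn by (intro mult_right_mono mult_left_mono) auto
    finally have "2 ^ j \<le> 4 * n * card P" .
    then have "2 ^ (j + 1) * k \<le> (8 * n * card P) * k" by (intro mult_right_mono) auto
    then have "N \<le> 8 * n * card P * k" using Nk by linarith
    then have "real N \<le> real (8 * n * card P * k)" by (rule of_nat_mono)
    then show "real N / (8 * real n) * (1 / real k) \<le> real (card P)"
      using n(1) k(1) by (simp add: divide_simps mult_ac)
  qed
qed

text \<open>
  The prime factors of \<open>k\<close> are bounded by \<open>2 ^ (n div 80)\<close>: this is a small enough power of \<open>N\<close> for at most a quarter
  of the weight to lie on \<open>k > 2 ^ (n div 4)\<close>, and a large enough one for the total weight to be of order \<open>n\<close>.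
  The other losses being one half, the rest has weight at least a quarter. The
  numbers \<open>p k\<close> are distinct because \<open>p\<close> exceeds all prime factors of \<open>k\<close>.
\<close>
lemma card_A_set_lower:
  assumes Z: "\<And>Q. finite Q \<Longrightarrow> (\<And>p. p \<in> Q \<Longrightarrow> prime p) \<Longrightarrow> (\<And>p. p \<in> Q \<Longrightarrow> Z < p) \<Longrightarrow>
    (\<Sum>S | S \<subseteq> Q \<and> obstructed (\<Prod>S). recip_mass S) \<le> 1/2 * total_mass Q"
    and n: "80 \<le> n" "2 ^ n \<le> N" "N < 2 ^ Suc n"
  shows "real N / (20480 * total_mass (primes_upto Z)) \<le> real (card (A_set N))"
proof -
  define J where "J = n div 80"
  define Q where "Q = primes_upto (2 ^ J) - primes_upto Z"
  have Q: "finite Q" "\<And>p. p \<in> Q \<Longrightarrow> prime p" "\<And>p. p \<in> Q \<Longrightarrow> Z < p" by (auto simp: Q_def)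
  have M: "0 < total_mass Q" by (rule total_mass_pos)
  define G where "G = {S. S \<subseteq> Q \<and> \<not> obstructed (\<Prod>S) \<and> \<Prod>S \<le> 2 ^ (n div 4)}"
  have fin: "finite {S. S \<subseteq> Q \<and> P S}" for P
    by (rule finite_subset[of _ "Pow Q"]) (use Q(1) in auto)
  have finG: "finite G" unfolding G_def by (rule fin)
  have large: "(\<Sum>S | S \<subseteq> Q \<and> 2 ^ (n div 4) < \<Prod>S. recip_mass S) \<le> 1/4 * total_mass Q"
  proof -
    have "(\<Sum>p\<in>Q. ln (real p) / real p) \<le> (\<Sum>p\<in>primes_upto (2 ^ J). ln (real p) / real p)"
      unfolding Q_def by (intro sum_mono2) (auto intro!: divide_nonneg_nonneg ln_ge_zero simp: Suc_le_eq prime_gt_0_nat)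
    also have "\<dots> \<le> 4 * real J * ln 2" by (rule sum_ln_primes_upper)
    finally have "(\<Sum>p\<in>Q. ln (real p) / real p) / (real (n div 4) * ln 2) \<le> (4 * real J * ln 2) / (real (n div 4) * ln 2)"
      by (intro divide_right_mono) auto
    also have "\<dots> \<le> 1/4"
    proof -
      have "16 * J \<le> n div 4" "0 < n div 4" using n(1) unfolding J_def by linarith+
      then have "16 * real J \<le> real (n div 4)" "0 < real (n div 4)" by linarith+
      then show ?thesis by (simp add: divide_simps)
    qed
    finally have r: "(\<Sum>p\<in>Q. ln (real p) / real p) / (real (n div 4) * ln 2) \<le> 1/4" .
    have "0 < n div 4" using n(1) by linarith
    from mass_large_products_le[OF Q(1,2) this] mult_right_mono[OF r, of "total_mass Q"] M
    show ?thesis by linarith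
  qed
  have "total_mass Q = (\<Sum>S\<in>Pow Q. recip_mass S)" using sum_recip_mass[OF Q(1)] by simp
  also have "\<dots> \<le> (\<Sum>S\<in>(G \<union> {S. S \<subseteq> Q \<and> obstructed (\<Prod>S)}) \<union> {S. S \<subseteq> Q \<and> 2 ^ (n div 4) < \<Prod>S}. recip_mass S)"
  proof (rule sum_mono2)
    show "Pow Q \<subseteq> (G \<union> {S. S \<subseteq> Q \<and> obstructed (\<Prod>S)}) \<union> {S. S \<subseteq> Q \<and> 2 ^ (n div 4) < \<Prod>S}"
      unfolding G_def by (auto simp only: Pow_iff Un_iff mem_Collect_eq not_le)
  qed (use finG fin recip_mass_nonneg in \<open>simp_all only: finite_Un\<close>)
  also have "\<dots> \<le> sum recip_mass G + sum recip_mass {S. S \<subseteq> Q \<and> obstructed (\<Prod>S)} + sum recip_mass {S. S \<subseteq> Q \<and> 2 ^ (n div 4) < \<Prod>S}"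
  proof -
    have un: "sum recip_mass (A \<union> B) \<le> sum recip_mass A + sum recip_mass B" if "finite A" "finite B" for A B
      using sum.union_inter[OF that, of recip_mass] sum_nonneg[of "A \<inter> B" recip_mass] recip_mass_nonneg by simp
    show ?thesis
      by (intro order_trans[OF un add_right_mono[OF un]] finite_UnI finG fin)
  qed
  also have "\<dots> \<le> sum recip_mass G + 1/2 * total_mass Q + 1/4 * total_mass Q"
    by (intro add_mono large Z Q) auto
  finally have massG: "1/4 * total_mass Q \<le> sum recip_mass G" by simp
  obtain P where P: "\<And>k. 0 < k \<Longrightarrow> k \<le> 2 ^ (n div 4) \<Longrightarrow> finite (P k) \<and> 
      (\<forall>p\<in>P k. prime p \<and> 258 * k < p \<and> p * k \<le> N \<and> N < 128 * (p * k) \<and> 2 ^ J < p) \<and>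
      real N / (8 * real n) * (1 / real k) \<le> real (card (P k))"
    using prime_slots[OF n] unfolding J_def by metis
  have Gp: "0 < \<Prod>S" "\<Prod>S \<le> 2 ^ (n div 4)" "S \<subseteq> Q" "finite S" if "S \<in> G" for S
  proof -
    show "S \<subseteq> Q" "\<Prod>S \<le> 2 ^ (n div 4)" using that by (auto simp: G_def)
    then show "finite S" using Q(1) finite_subset by auto
    show "0 < \<Prod>S" using \<open>S \<subseteq> Q\<close> Q(2) by (intro prod_pos) (auto intro!: prime_gt_0_nat)
  qed
  let ?I = "SIGMA S:G. P (\<Prod>S)"
  let ?f = "\<lambda>(S, p). p * \<Prod>S"
  have "inj_on ?f ?I"
  proof (rule inj_onI)
    fix u v assume uv: "u \<in> ?I" "v \<in> ?I" "?f u = ?f v"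
    obtain S p T q where e: "u = (S, p)" "v = (T, q)" by (metis surj_pair)
    \<comment> \<open>The set \<open>R\<close> is recovered from \<open>r * \<Prod>R\<close> as its prime factors in \<open>Q\<close>.\<close>
    have rec: "R = prime_factors (r * \<Prod>R) \<inter> Q" if "R \<in> G" "r \<in> P (\<Prod>R)" for R r
    proof -
      have r: "prime r" "2 ^ J < r" using P[OF Gp(1,2)[OF that(1)]] that(2) by auto
      then have "r \<notin> Q" by (auto simp: Q_def)
      have "prime_factors (\<Prod>R) = R"
      proof -
        have "prime_factorization (\<Prod>R) = mset_set R"
          using prime_factorization_prod_mset_primes[of "mset_set R"] Gp[OF that(1)] Q(2)
          by (auto simp: prod_unfold_prod_mset)
        then show ?thesis using Gp(4)[OF that(1)] by simp
      qed
      then have "prime_factors (r * \<Prod>R) = insert r R"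
        using r(1) Gp(1)[OF that(1)] by (subst prime_factors_product) (auto simp: prime_factorization_prime)
      then show ?thesis using \<open>r \<notin> Q\<close> Gp(3)[OF that(1)] by auto
    qed
    have eq: "p * \<Prod>S = q * \<Prod>T" using uv(3) by (simp add: e)
    have "S = prime_factors (p * \<Prod>S) \<inter> Q" using uv(1) by (intro rec) (auto simp: e)
    also have "\<dots> = prime_factors (q * \<Prod>T) \<inter> Q" by (simp only: eq)
    also have "\<dots> = T" using uv(2) by (intro rec[symmetric]) (auto simp: e)
    finally have "S = T" .
    moreover have "0 < \<Prod>S" using uv(1) Gp(1) by (auto simp: e)
    ultimately show "u = v" using eq e by simp
  qed
  moreover have "?f ` ?I \<subseteq> A_set N"
  proof clarify
    fix S p assume Sp: "S \<in> G" "p \<in> P (\<Prod>S)"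
    then show "p * \<Prod>S \<in> A_set N"
      using P[OF Gp(1,2)[OF Sp(1)]] Gp(1)[OF Sp(1)] by (intro mult_unobstructed_in_A_set) (auto simp: G_def)
  qed
  moreover have "finite (A_set N)" by (simp add: A_set_def)
  ultimately have "card ?I \<le> card (A_set N)" by (rule card_inj_on_le)
  moreover have "card ?I = (\<Sum>S\<in>G. card (P (\<Prod>S)))"
    using finG P Gp by (intro card_SigmaI) auto
  ultimately have "(\<Sum>S\<in>G. card (P (\<Prod>S))) \<le> card (A_set N)" by simp
  then have "real (\<Sum>S\<in>G. card (P (\<Prod>S))) \<le> real (card (A_set N))" by (rule of_nat_mono)
  then have "(\<Sum>S\<in>G. real (card (P (\<Prod>S)))) \<le> real (card (A_set N))" by simp
  moreover have "(\<Sum>S\<in>G. real N / (8 * real n) * recip_mass S) \<le> (\<Sum>S\<in>G. real (card (P (\<Prod>S))))"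
  proof (rule sum_mono)
    fix S assume S: "S \<in> G"
    have "recip_mass S = 1 / real (\<Prod>S)" by (simp add: recip_mass_def prod_dividef)
    then show "real N / (8 * real n) * recip_mass S \<le> real (card (P (\<Prod>S)))"
      using P[OF Gp(1,2)[OF S]] by simp
  qed
  moreover have "(\<Sum>S\<in>G. real N / (8 * real n) * recip_mass S) = real N / (8 * real n) * sum recip_mass G"
    by (simp only: sum_distrib_left)
  moreover have "real N / (20480 * total_mass (primes_upto Z)) \<le> real N / (8 * real n) * sum recip_mass G"
  proof -
    let ?C = "total_mass (primes_upto Z)"
    have C: "0 < ?C" by (rule total_mass_pos)
    have "real J / 4 \<le> total_mass (primes_upto (2 ^ J))"
      unfolding total_mass_def by (rule prod_primes_lower)
    also have "\<dots> \<le> total_mass (Q \<union> primes_upto Z)"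
      unfolding total_mass_def Q_def by (intro prod_mono2) auto
    also have "\<dots> = total_mass Q * ?C"
      unfolding total_mass_def by (intro prod.union_disjoint) (auto simp: Q_def)
    finally have "real J / 4 / ?C \<le> total_mass Q" using C by (simp add: pos_divide_le_eq)
    moreover have "n \<le> 160 * J"
    proof -
      have "n < (J + 1) * 80" using dividend_less_div_times[of 80 n] by (simp add: J_def)
      moreover have "1 \<le> J" using div_le_mono[OF n(1), of 80] by (simp add: J_def)
      ultimately show ?thesis by simp
    qed
    then have "real n / 160 \<le> real J" by linarith
    then have "real n / 160 / 4 / ?C \<le> real J / 4 / ?C" using C by (intro divide_right_mono) auto
    ultimately have "1/4 * (real n / 160 / 4 / ?C) \<le> sum recip_mass G" using massG by linarith
    then have "real N / (8 * real n) * (1/4 * (real n / 160 / 4 / ?C)) \<le> real N / (8 * real n) * sum recip_mass G"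
      by (intro mult_left_mono) auto
    moreover have "real N / (8 * real n) * (1/4 * (real n / 160 / 4 / ?C)) = real N / (20480 * ?C)"
      using n(1) by simp
    ultimately show ?thesis by simp
  qed
  ultimately show ?thesis by linarith
qed

theorem theorem1:
  shows "(\<forall>N::nat. 0 < N \<longrightarrow> (\<forall>a \<in> A_set N. \<forall>b \<in> A_set N. a \<noteq> b \<longrightarrow> \<not> (a + b) dvd (2 * a * b)))
    \<and> (\<exists>c::real. c > 0 \<and> (\<forall>\<^sub>F N in sequentially. real (card (A_set N)) > c * real N))"
proof (intro conjI allI impI ballI)
  fix N a b :: nat
  assume "0 < N" and ab: "a \<in> A_set N" "b \<in> A_set N" "a \<noteq> b"
  show "\<not> (a + b) dvd (2 * a * b)"
  proof (cases "big_omega b \<le> big_omega a")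
    case True
    then show ?thesis using ab by (auto simp: A_set_def)
  next
    case False
    then have "\<not> (b + a) dvd (2 * b * a)" using ab by (auto simp: A_set_def)
    then show ?thesis by (simp add: add.commute mult_ac)
  qed
next
  obtain Z where Z: "\<And>Q. finite Q \<Longrightarrow> (\<And>p. p \<in> Q \<Longrightarrow> prime p) \<Longrightarrow> (\<And>p. p \<in> Q \<Longrightarrow> Z < p) \<Longrightarrow>
    (\<Sum>S | S \<subseteq> Q \<and> obstructed (\<Prod>S). recip_mass S) \<le> 1/2 * total_mass Q"
    using obstructed_mass by blast
  define C where "C = 20480 * total_mass (primes_upto Z)"
  have C: "0 < C" using total_mass_pos[of "primes_upto Z"] by (simp add: C_def)
  show "\<exists>c::real. c > 0 \<and> (\<forall>\<^sub>F N in sequentially. real (card (A_set N)) > c * real N)"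
  proof (intro exI[of _ "1 / (2 * C)"] conjI)
    show "0 < 1 / (2 * C)" using C by simp
    show "\<forall>\<^sub>F N in sequentially. real (card (A_set N)) > 1 / (2 * C) * real N"
      using eventually_ge_at_top[of "2 ^ 80"]
    proof eventually_elim
      case (elim N)
      then have N1: "1 \<le> N" by (rule order_trans[rotated]) simp
      obtain n where n: "2 ^ n \<le> N" "N < 2 ^ (n + 1)" using ex_power_ivl1[of 2 N] N1 by auto
      have "(2::nat) ^ 80 < 2 ^ (n + 1)" using elim n(2) by (rule order.strict_trans1)
      then have "80 < n + 1" by (rule power_less_imp_less_exp[rotated]) simp
      then have "real N / C \<le> real (card (A_set N))"
        unfolding C_def using n by (intro card_A_set_lower[of Z n, OF Z]) auto
      moreover have "1 / (2 * C) * real N < real N / C" using C N1 by (simp add: field_simps)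
      ultimately show ?case by linarith
    qed
  qed
qed

end
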